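(* Let $\kappa>0$ and let $\rho:\mathbb{R}\to\mathbb{R}$ be Lipschitz continuous with $\rho^2(x)=\lambda^2(\varsigma^2+x^2)$ for all $x\in\mathbb{R}$, where $\lambda\ne0$ and $\varsigma\ge0$. Let $g\equiv0$ and $\mu=\delta_0$ (Dirac measure at $0$), and let $u$ be the solution of $u(t,x)=J_0(t,x)+\iint_{[0,t]\times\mathbb{R}}G_\kappa(t-s,x-y)\rho(u(s,y))W(ds,dy)$ with these initial data. Then for all $t\ge0$ and $x,y\in\mathbb{R}$, $$E[u(t,x)u(t,y)]=\frac1{\lambda^2}\,\mathcal K\Big(T_\kappa(t,x-y),\frac{x+y}2\Big)+\varsigma^2\,\mathcal H\big(T_\kappa(t,x-y)\big).$$ In particular, $\|u(t,x)\|_2^2=\frac1{\lambda^2}\mathcal K(t,x)+\varsigma^2\mathcal H(t)$.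
   Context: $W$ is a space-time white noise on $\mathbb{R}_+\times\mathbb{R}$ (with $\mathbb{R}_+=[0,\infty)$), $(\mathcal F_t)$ its natural augmented filtration, stochastic integrals are in the sense of Walsh, $\|\cdot\|_2$ is the $L^2(\Omega)$-norm. $G_\kappa(t,x)=\frac12 1_{\{t\ge0\}}1_{[-\kappa t,\kappa t]}(x)$ and $J_0(t,x)=\frac12(g(x+\kappa t)+g(x-\kappa t))+\int_{\mathbb{R}}G_\kappa(t,x-y)\mu(dy)$, where $g$ is the initial position and $\mu$ the initial velocity, so here $J_0=G_\kappa$. A solution is an adapted, jointly measurable random field $u=J_0+I$ satisfying the integral equation, with $I$ the stochastic integral, such that $\int_0^t\int_{\mathbb{R}} G_\kappa^2(t-s,x-y)\|\rho(u(s,y))\|_2^2\,dy\,ds<\infty$ for all $t>0,x\in\mathbb{R}$ and $(t,x)\mapsto I(t,x)$ is continuous from $\mathbb{R}_+\times\mathbb{R}$ into $L^2(\Omega)$; such a solution exists and is unique up to versions. $\mathcal K(t,x)=\frac{\lambda^2}4I_0\Big(\sqrt{\tfrac{\lambda^2((\kappa t)^2-x^2)}{2\kappa}}\Big)$ if $-\kappa t\le x\le\kappa t$ and $0$ otherwise, $I_0$ being the modified Bessel function of the first kind of order $0$; $\mathcal H(t)=\cosh(|\lambda|\sqrt{\kappa/2}\,t)-1$; $T_\kappa(t,x)=\big(t-\frac{|x|}{2\kappa}\big)1_{\{|x|\le2\kappa t\}}$.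
   Formalization: When x+y=0 and |x-y|>2κt (e.g. t=0, x=-y≠0), the printed covariance formula gives 1/4 because T_κ=0 and K(0,0)=λ²/4, but the true covariance is 0; the formal statement gives 0 in exactly this case and the printed formula otherwise. *)

theory Defs
  imports "HOL-Probability.Probability"
begin

section \<open>Space-time white noise on \<open>\<real>\<^sub>+ \<times> \<real>\<close>\<close>

definition spacetime :: "(real \<times> real) measure" where
  "spacetime = restrict_space lborel ({0..} \<times> UNIV)"

text \<open>Constants count as (degenerate) Gaussian variables.\<close>

definition gaussian_rv :: "'a measure \<Rightarrow> ('a \<Rightarrow> real) \<Rightarrow> bool" where
  "gaussian_rv M X \<longleftrightarrow> X \<in> borel_measurable M \<and>
     ((\<exists>m s. s > 0 \<and> distributed M lborel X (\<lambda>x. ennreal (normal_density m s x))) \<or>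
      (\<exists>m. AE \<omega> in M. X \<omega> = m))"

definition noise_sets :: "(real \<times> real) set set" where
  "noise_sets = {A \<in> sets spacetime. emeasure spacetime A < \<infinity>}"

definition white_noise :: "'a measure \<Rightarrow> ((real \<times> real) set \<Rightarrow> 'a \<Rightarrow> real) \<Rightarrow> bool" where
  "white_noise M W \<longleftrightarrow> prob_space M \<and>
     (\<forall>F c. finite F \<longrightarrow> F \<subseteq> noise_sets \<longrightarrow> gaussian_rv M (\<lambda>\<omega>. \<Sum>A\<in>F. c A * W A \<omega>)) \<and>
     (\<forall>A\<in>noise_sets. has_bochner_integral M (W A) 0) \<and>
     (\<forall>A\<in>noise_sets. \<forall>B\<in>noise_sets.
        has_bochner_integral M (\<lambda>\<omega>. W A \<omega> * W B \<omega>) (measure spacetime (A \<inter> B)))"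

text \<open>The natural filtration, augmented by the null sets of the underlying probability space.\<close>

definition noise_filtration ::
    "'a measure \<Rightarrow> ((real \<times> real) set \<Rightarrow> 'a \<Rightarrow> real) \<Rightarrow> real \<Rightarrow> 'a measure" where
  "noise_filtration M W t = sigma (space M)
     ({W A -` B \<inter> space M | A B. A \<in> noise_sets \<and> A \<subseteq> {0..t} \<times> UNIV \<and> B \<in> sets borel}
      \<union> null_sets M)"

section \<open>The Walsh stochastic integral\<close>

text \<open>
  A list entry \<open>(a, b, A, Y)\<close> stands for the elementary process
  \<open>Y(\<omega>) 1\<^bsub>(a,b]\<^esub>(s) 1\<^bsub>A\<^esub>(y)\<close>, and a list for the sum of its entries.
\<close>

type_synonym 'a simple_process = "(real \<times> real \<times> real set \<times> ('a \<Rightarrow> real)) list"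

definition valid_simple ::
    "'a measure \<Rightarrow> ((real \<times> real) set \<Rightarrow> 'a \<Rightarrow> real) \<Rightarrow> 'a simple_process \<Rightarrow> bool" where
  "valid_simple M W E \<longleftrightarrow> (\<forall>(a, b, A, Y) \<in> set E.
     0 \<le> a \<and> a < b \<and> A \<in> sets borel \<and> emeasure lborel A < \<infinity> \<and>
     Y \<in> borel_measurable (noise_filtration M W a) \<and> (\<exists>C. \<forall>\<omega>\<in>space M. \<bar>Y \<omega>\<bar> \<le> C))"

definition simple_field :: "'a simple_process \<Rightarrow> real \<times> real \<Rightarrow> 'a \<Rightarrow> real" where
  "simple_field E z \<omega> = (\<Sum>(a, b, A, Y) \<leftarrow> E. Y \<omega> * indicator ({a<..b} \<times> A) z)"

definition simple_integral ::
    "((real \<times> real) set \<Rightarrow> 'a \<Rightarrow> real) \<Rightarrow> 'a simple_process \<Rightarrow> 'a \<Rightarrow> real" where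
  "simple_integral W E \<omega> = (\<Sum>(a, b, A, Y) \<leftarrow> E. Y \<omega> * W ({a<..b} \<times> A) \<omega>)"

text \<open>The square of the \<open>L\<^sup>2(\<Omega>)\<close>-norm, with value \<open>\<infinity>\<close> outside \<open>L\<^sup>2(\<Omega>)\<close>.\<close>

definition L2_norm_sq :: "'a measure \<Rightarrow> ('a \<Rightarrow> real) \<Rightarrow> ennreal" where
  "L2_norm_sq M Z = (\<integral>\<^sup>+ \<omega>. ennreal ((Z \<omega>)\<^sup>2) \<partial>M)"

text \<open>
  \<open>Z\<close> is (a version of) \<open>\<integral>\<integral>\<^bsub>\<real>\<^sub>+ \<times> \<real>\<^esub> X(s,y) W(ds,dy)\<close>.  By the Ito-Walsh isometry the
  integral extends from simple processes to their closure in
  \<open>L\<^sup>2(\<real>\<^sub>+ \<times> \<real> \<times> \<Omega>)\<close>, and \<open>Z\<close> is determined by \<open>X\<close> up to a null set.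
\<close>

definition has_walsh_integral ::
    "'a measure \<Rightarrow> ((real \<times> real) set \<Rightarrow> 'a \<Rightarrow> real) \<Rightarrow>
     (real \<times> real \<Rightarrow> 'a \<Rightarrow> real) \<Rightarrow> ('a \<Rightarrow> real) \<Rightarrow> bool" where
  "has_walsh_integral M W X Z \<longleftrightarrow>
     (\<lambda>(z, \<omega>). X z \<omega>) \<in> borel_measurable (spacetime \<Otimes>\<^sub>M M) \<and>
     (\<integral>\<^sup>+ (z, \<omega>). ennreal ((X z \<omega>)\<^sup>2) \<partial>(spacetime \<Otimes>\<^sub>M M)) < \<infinity> \<and>
     Z \<in> borel_measurable M \<and> L2_norm_sq M Z < \<infinity> \<and>
     (\<exists>E. (\<forall>n. valid_simple M W (E n)) \<and>
        (\<lambda>n. \<integral>\<^sup>+ (z, \<omega>). ennreal ((simple_field (E n) z \<omega> - X z \<omega>)\<^sup>2) \<partial>(spacetime \<Otimes>\<^sub>M M))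
          \<longlonglongrightarrow> 0 \<and>
        (\<lambda>n. L2_norm_sq M (\<lambda>\<omega>. simple_integral W (E n) \<omega> - Z \<omega>)) \<longlonglongrightarrow> 0)"

section \<open>The stochastic wave equation\<close>

definition G :: "real \<Rightarrow> real \<Rightarrow> real \<Rightarrow> real" where
  "G \<kappa> t x = 1/2 * indicator {0..} t * indicator {- \<kappa> * t .. \<kappa> * t} x"

definition J0 :: "real \<Rightarrow> (real \<Rightarrow> real) \<Rightarrow> real measure \<Rightarrow> real \<Rightarrow> real \<Rightarrow> real" where
  "J0 \<kappa> g \<mu> t x = 1/2 * (g (x + \<kappa> * t) + g (x - \<kappa> * t)) + (\<integral>y. G \<kappa> t (x - y) \<partial>\<mu>)"

lemma J0_dirac: "J0 \<kappa> (\<lambda>_. 0) (return borel 0) t x = G \<kappa> t x"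
proof -
  have "(\<lambda>y. G \<kappa> t (x - y)) \<in> borel_measurable borel"
    unfolding G_def by measurable
  then show ?thesis
    by (simp add: J0_def integral_return)
qed

text \<open>
  Random fields on \<open>\<real>\<^sub>+ \<times> \<real>\<close> are functions of a real time variable; their values at
  negative times are never used.
\<close>

definition wave_solution ::
    "'a measure \<Rightarrow> ((real \<times> real) set \<Rightarrow> 'a \<Rightarrow> real) \<Rightarrow> real \<Rightarrow> (real \<Rightarrow> real) \<Rightarrow>
     (real \<Rightarrow> real) \<Rightarrow> real measure \<Rightarrow> (real \<Rightarrow> real \<Rightarrow> 'a \<Rightarrow> real) \<Rightarrow> bool" where
  "wave_solution M W \<kappa> \<rho> g \<mu> u \<longleftrightarrow>
     (\<forall>t\<ge>0. \<forall>x. u t x \<in> borel_measurable (noise_filtration M W t)) \<and>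
     (\<lambda>((t, x), \<omega>). u t x \<omega>) \<in> borel_measurable (spacetime \<Otimes>\<^sub>M M) \<and>
     (\<forall>t>0. \<forall>x. (\<integral>\<^sup>+ (s, y). indicator {0..t} s * ennreal ((G \<kappa> (t - s) (x - y))\<^sup>2) *
                   L2_norm_sq M (\<lambda>\<omega>. \<rho> (u s y \<omega>)) \<partial>spacetime) < \<infinity>) \<and>
     (\<exists>I. (\<forall>t\<ge>0. \<forall>x. has_walsh_integral M W
                (\<lambda>(s, y) \<omega>. indicator {0..t} s * G \<kappa> (t - s) (x - y) * \<rho> (u s y \<omega>)) (I t x)) \<and>
          (\<forall>t\<ge>0. \<forall>x. ((\<lambda>(s, y). L2_norm_sq M (\<lambda>\<omega>. I s y \<omega> - I t x \<omega>)) \<longlongrightarrow> 0)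
                (at (t, x) within {0..} \<times> UNIV)) \<and>
          (\<forall>t\<ge>0. \<forall>x. AE \<omega> in M. u t x \<omega> = J0 \<kappa> g \<mu> t x + I t x \<omega>))"

section \<open>The functions in the moment formula\<close>

text \<open>The modified Bessel function of the first kind, for orders \<open>m \<in> \<nat>\<close>.\<close>

definition bessel_I :: "nat \<Rightarrow> real \<Rightarrow> real" where
  "bessel_I m z = (\<Sum>n. (z / 2) ^ (2 * n + m) / (fact n * fact (n + m)))"

definition K_fun :: "real \<Rightarrow> real \<Rightarrow> real \<Rightarrow> real \<Rightarrow> real" where
  "K_fun \<kappa> l t x = (if - \<kappa> * t \<le> x \<and> x \<le> \<kappa> * t
     then l\<^sup>2 / 4 * bessel_I 0 (sqrt (l\<^sup>2 * ((\<kappa> * t)\<^sup>2 - x\<^sup>2) / (2 * \<kappa>))) else 0)"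

definition H_fun :: "real \<Rightarrow> real \<Rightarrow> real \<Rightarrow> real" where
  "H_fun \<kappa> l t = cosh (\<bar>l\<bar> * sqrt (\<kappa> / 2) * t) - 1"

definition T_fun :: "real \<Rightarrow> real \<Rightarrow> real \<Rightarrow> real" where
  "T_fun \<kappa> t x = (t - \<bar>x\<bar> / (2 * \<kappa>)) * indicator {- 2 * \<kappa> * t .. 2 * \<kappa> * t} x"

text \<open>
  A pitfall of the convention \<open>T\<^sub>\<kappa> = 0\<close> for disjoint backward light cones: if
  \<open>\<bar>x - y\<bar> > 2\<kappa>t\<close> and \<open>x + y = 0\<close>, then \<open>\<K>(T\<^sub>\<kappa>(t, x - y), (x + y)/2) = \<K>(0, 0)\<close>, which is
  \<open>\<lambda>\<^sup>2/4\<close> and not \<open>0\<close>, although \<open>u(t,x)\<close> and \<open>u(t,y)\<close> are then uncorrelated with mean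
  \<open>G\<^sub>\<kappa>(t,x) = G\<^sub>\<kappa>(t,y) = 0\<close>.  The covariance formula must be read as \<open>0\<close> there.
\<close>

lemma moment_formula_degenerate:
  assumes "l \<noteq> 0" "x + y = 0" "2 * \<kappa> * t < \<bar>x - y\<bar>"
  shows "1 / l\<^sup>2 * K_fun \<kappa> l (T_fun \<kappa> t (x - y)) ((x + y) / 2)
           + v\<^sup>2 * H_fun \<kappa> l (T_fun \<kappa> t (x - y)) = 1/4"
proof -
  have T: "T_fun \<kappa> t (x - y) = 0"
    using assms(3) by (auto simp: T_fun_def indicator_def)
  have "bessel_I 0 0 = 1"
    unfolding bessel_I_def by (subst suminf_finite[of "{0}"]) (auto simp: power_0_left)
  with T assms show ?thesis
    by (simp add: K_fun_def H_fun_def)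
qed

end

theory Submission
  imports Defs
begin

text \<open>
  Let \<open>N(t,x) = E[u(t,x)\<^sup>2]\<close>.  The stochastic integral \<open>I(t,x)\<close> has mean zero, and by the
  Walsh isometry its covariance is the integral of the product of the two kernels against
  \<open>E[\<rho>(u)\<^sup>2] = \<lambda>\<^sup>2(\<varsigma>\<^sup>2 + N)\<close>.  The kernel is half the indicator of the backward light cone, so
  \<open>N\<close> solves the linear Volterra equation
  \<open>N(t,x) = G(t,x)\<^sup>2 + \<lambda>\<^sup>2/4 \<integral>\<integral>\<^bsub>cone(t,x)\<^esub> (\<varsigma>\<^sup>2 + N)\<close>.

  \<^bold>\<open>Solving the equation.\<close>  For \<open>V = \<varsigma>\<^sup>2 + N\<close> it reads \<open>V = m\<^sub>0 + \<T>V\<close> with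
  \<open>m\<^sub>0 = G\<^sup>2 + \<varsigma>\<^sup>2\<close> and \<open>\<T>\<close> equal to \<open>\<lambda>\<^sup>2/4\<close> times integration over the cone.  Its Picard
  iterates are explicit: \<open>\<T>\<close> sends each term of the power series of
  \<open>cosh (\<bar>\<lambda>\<bar> sqrt (\<kappa>/2) t)\<close> to the next one, and likewise each term of the Bessel series of
  \<open>\<K>/\<lambda>\<^sup>2\<close>, because in the coordinates \<open>p = \<kappa>s + y\<close>, \<open>q = \<kappa>s - y\<close> the part of the cone where
  these terms live is a rectangle and the terms are monomials in \<open>pq\<close>.  The sum of the iterates is
  the least nonnegative solution.  Conversely, the equation itself bounds \<open>V\<close> on
  \<open>cone(t,x)\<close> in terms of the finite number \<open>V(t,x)\<close>, since cones of points in the cone are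
  contained in it; iterating the equation on this bound leaves a remainder that is a constant times
  a term of the \<open>cosh\<close> series and tends to zero.  Everything is monotone and nonnegative, so
  the argument runs in \<open>[0,\<infinity>]\<close> without integrability side conditions
  (\<open>picard_sum\<close>, \<open>second_moment_equation_solution\<close>).

  \<^bold>\<open>Two points.\<close>  Two backward cones with apices at the same time \<open>t\<close> intersect in the backward
  cone of \<open>(T\<^sub>\<kappa>(t,x-y), (x+y)/2)\<close>, or not at all.  Hence the expression for
  \<open>E[u(t,x)u(t,y)]\<close> is literally the right-hand side of the equation for \<open>N\<close> at that point
  (\<open>back_cone_Int\<close>).

  \<^bold>\<open>The isometry.\<close>  For elementary processes it needs that the noise on
  \<open>(a,\<infinity>) \<times> \<real>\<close> is independent of the \<open>\<sigma>\<close>-algebra of the noise on \<open>[0,a] \<times> \<real>\<close>.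
  The noise is only known through the Gaussianity of its finite linear combinations, so independence
  is derived from characteristic functions: they factorise because the covariance vanishes, and
  exponentials are replaced by indicators one variable at a time using the one-dimensional
  uniqueness theorem of Levy (\<open>fourier_zero\<close>, \<open>cylinder_fourier\<close>, \<open>indep_past_future\<close>).
  The passage to the \<open>L\<^sup>2\<close>-closure is the continuity of the inner product
  (\<open>walsh_isometry\<close>).
\<close>

section \<open>Fourier uniqueness and independence\<close>

context prob_space begin

text \<open>
  Weighting the probability measure by \<open>V\<close> turns expectations that contain the factor \<open>V\<close> into
  data of a law on the line, to which the uniqueness theorem for characteristic functions applies.
\<close>

lemma weighted_law:
  fixes V X :: "'a \<Rightarrow> real"
  assumes [measurable]: "V \<in> borel_measurable M" "X \<in> borel_measurable M"
    and nonneg: "\<And>\<omega>. 0 \<le> V \<omega>" and bdd: "\<And>\<omega>. V \<omega> \<le> C" and one: "expectation V = 1"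
  defines "\<mu> \<equiv> distr (density M V) borel X"
  shows "real_distribution \<mu>"
    and "char \<mu> t = (CLINT \<omega>|M. V \<omega> * iexp (t * X \<omega>))"
    and "B \<in> sets borel \<Longrightarrow> measure \<mu> B = expectation (\<lambda>\<omega>. V \<omega> * indicator B (X \<omega>))"
proof -
  have V: "integrable M V"
    by (rule integrable_const_bound[where B=C]) (use nonneg bdd in auto)
  have "emeasure (density M V) (space (density M V)) = ennreal (expectation V)"
    using V nonneg by (simp add: emeasure_density nn_integral_eq_integral cong: nn_integral_cong)
  then interpret D: prob_space "density M V"
    by (intro prob_spaceI) (simp add: one)
  show "real_distribution \<mu>"
    unfolding \<mu>_def by (intro real_distribution.intro real_distribution_axioms.intro D.prob_space_distr) auto
  show "char \<mu> t = (CLINT \<omega>|M. V \<omega> * iexp (t * X \<omega>))"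
    using nonneg unfolding char_def \<mu>_def
    by (subst integral_distr, simp_all, subst integral_density)
       (auto simp: scaleR_conv_of_real)
  assume [measurable]: "B \<in> sets borel"
  have "emeasure \<mu> B = (\<integral>\<^sup>+\<omega>. ennreal (V \<omega> * indicator B (X \<omega>)) \<partial>M)"
    unfolding \<mu>_def
    by (subst emeasure_distr, simp_all, subst emeasure_density)
       (auto intro!: nn_integral_cong simp: indicator_def)
  then show "measure \<mu> B = expectation (\<lambda>\<omega>. V \<omega> * indicator B (X \<omega>))"
    using nonneg by (subst integral_eq_nn_integral) (auto simp: measure_def)
qed

text \<open>
  Split \<open>Z\<close> into its positive and negative part.  The hypothesis at \<open>t = 0\<close> says that both
  have the same mean; weighting by either part, normalised, gives two laws of \<open>X\<close> with equal
  characteristic functions, hence equal laws.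
\<close>

lemma fourier_zero_real:
  fixes Z X :: "'a \<Rightarrow> real"
  assumes [measurable]: "Z \<in> borel_measurable M" "X \<in> borel_measurable M" "B \<in> sets borel"
    and bdd: "\<And>\<omega>. \<bar>Z \<omega>\<bar> \<le> C"
    and zero: "\<And>t. (CLINT \<omega>|M. Z \<omega> * iexp (t * X \<omega>)) = 0"
  shows "expectation (\<lambda>\<omega>. Z \<omega> * indicator B (X \<omega>)) = 0"
proof -
  define P where "P \<omega> = max (Z \<omega>) 0" for \<omega>
  define N where "N \<omega> = max (- Z \<omega>) 0" for \<omega>
  have [measurable]: "P \<in> borel_measurable M" "N \<in> borel_measurable M"
    unfolding P_def N_def by measurable
  have Z: "Z \<omega> = P \<omega> - N \<omega>" for \<omega> by (simp add: P_def N_def max_def)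
  have b: "0 \<le> P \<omega>" "0 \<le> N \<omega>" "P \<omega> \<le> C" "N \<omega> \<le> C" for \<omega>
    using bdd[of \<omega>] by (auto simp: P_def N_def)
  have int: "integrable M P" "integrable M N"
    using b by (auto intro!: integrable_const_bound[where B=C])
  have intc: "integrable M (\<lambda>\<omega>. complex_of_real (P \<omega>) * iexp (t * X \<omega>))"
             "integrable M (\<lambda>\<omega>. complex_of_real (N \<omega>) * iexp (t * X \<omega>))" for t
    using b by (auto intro!: integrable_const_bound[where B=C] simp: norm_mult)
  have intB: "integrable M (\<lambda>\<omega>. P \<omega> * indicator B (X \<omega>))"
             "integrable M (\<lambda>\<omega>. N \<omega> * indicator B (X \<omega>))"
    using b order_trans[OF b(1) b(3)]
    by (auto intro!: integrable_const_bound[where B=C] simp: indicator_def)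
  have eq: "(CLINT \<omega>|M. P \<omega> * iexp (t * X \<omega>)) = (CLINT \<omega>|M. N \<omega> * iexp (t * X \<omega>))" for t
    using zero[of t] intc[of t] by (simp add: Z left_diff_distrib)
  define c where "c = expectation P"
  have "complex_of_real (expectation P) = complex_of_real (expectation N)"
    using eq[of 0] by simp
  then have c': "expectation N = c" by (simp add: c_def)
  have "expectation (\<lambda>\<omega>. P \<omega> * indicator B (X \<omega>)) = expectation (\<lambda>\<omega>. N \<omega> * indicator B (X \<omega>))"
  proof (cases "c = 0")
    case True
    have "expectation P = 0" "expectation N = 0" using True c' by (simp_all add: c_def)
    then have "AE \<omega> in M. P \<omega> = 0" "AE \<omega> in M. N \<omega> = 0"
      using int b integral_nonneg_eq_0_iff_AE[of M P] integral_nonneg_eq_0_iff_AE[of M N] by simp_all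
    then show ?thesis
      by (intro integral_cong_AE) auto
  next
    case False
    with b have c: "c > 0" by (simp add: c_def less_le)
    define p where "p \<omega> = P \<omega> / c" for \<omega>
    define n where "n \<omega> = N \<omega> / c" for \<omega>
    have [measurable]: "p \<in> borel_measurable M" "n \<in> borel_measurable M"
      unfolding p_def n_def by measurable
    have pn: "0 \<le> p \<omega>" "0 \<le> n \<omega>" "p \<omega> \<le> C / c" "n \<omega> \<le> C / c" for \<omega>
      using b c by (auto simp: p_def n_def divide_right_mono)
    have one: "expectation p = 1" "expectation n = 1"
      using c c' unfolding p_def n_def by (simp_all add: c_def)
    note lp = weighted_law[OF _ _ pn(1) pn(3) one(1), of X]
    note ln = weighted_law[OF _ _ pn(2) pn(4) one(2), of X]
    have "distr (density M p) borel X = distr (density M n) borel X"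
    proof (rule Levy_uniqueness)
      show "char (distr (density M p) borel X) = char (distr (density M n) borel X)"
      proof
        fix t
        have "(CLINT \<omega>|M. p \<omega> * iexp (t * X \<omega>)) = (CLINT \<omega>|M. P \<omega> * iexp (t * X \<omega>)) / c"
          unfolding p_def by (simp flip: integral_divide_zero)
        also have "\<dots> = (CLINT \<omega>|M. n \<omega> * iexp (t * X \<omega>))"
          unfolding n_def eq by (simp flip: integral_divide_zero)
        finally show "char (distr (density M p) borel X) t = char (distr (density M n) borel X) t"
          using lp(2)[of t] ln(2)[of t] by simp
      qed
    qed (use lp(1) ln(1) in simp_all)
    then have "expectation (\<lambda>\<omega>. p \<omega> * indicator B (X \<omega>)) = expectation (\<lambda>\<omega>. n \<omega> * indicator B (X \<omega>))"
      using lp(3)[of B] ln(3)[of B] by simp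
    then show ?thesis
      using c by (simp add: p_def n_def)
  qed
  with intB show ?thesis
    by (simp add: Z left_diff_distrib)
qed

text \<open>
  The conjugate of the hypothesis at \<open>- t\<close> is the same hypothesis for the conjugate of \<open>Z\<close>, so
  it passes to the real and the imaginary part.
\<close>

lemma fourier_zero:
  fixes Z :: "'a \<Rightarrow> complex" and X :: "'a \<Rightarrow> real"
  assumes [measurable]: "Z \<in> borel_measurable M" "X \<in> borel_measurable M" "B \<in> sets borel"
    and bdd: "\<And>\<omega>. norm (Z \<omega>) \<le> C"
    and zero: "\<And>t. (CLINT \<omega>|M. Z \<omega> * iexp (t * X \<omega>)) = 0"
  shows "(CLINT \<omega>|M. Z \<omega> * indicator B (X \<omega>)) = 0"
proof -
  have [measurable]: "(\<lambda>\<omega>. cnj (Z \<omega>)) \<in> borel_measurable M"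
    by (simp add: borel_measurable_complex_iff)
  have i: "integrable M (\<lambda>\<omega>. Z \<omega> * iexp (t * X \<omega>))" "integrable M (\<lambda>\<omega>. cnj (Z \<omega>) * iexp (t * X \<omega>))" for t
    using bdd by (auto intro!: integrable_const_bound[where B=C] simp: norm_mult)
  \<comment> \<open>The hypothesis at \<open>- t\<close>, conjugated.\<close>
  have conj: "(CLINT \<omega>|M. cnj (Z \<omega>) * iexp (t * X \<omega>)) = 0" for t
  proof -
    have "(CLINT \<omega>|M. cnj (Z \<omega>) * iexp (t * X \<omega>)) = (CLINT \<omega>|M. cnj (Z \<omega> * iexp ((- t) * X \<omega>)))"
      by (simp add: exp_cnj)
    also have "\<dots> = 0"
      by (subst Bochner_Integration.integral_cnj) (use zero[of "-t"] in simp)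
    finally show ?thesis .
  qed
  have "expectation (\<lambda>\<omega>. Re (Z \<omega>) * indicator B (X \<omega>)) = 0"
  proof (rule fourier_zero_real[where C=C])
    show "\<bar>Re (Z \<omega>)\<bar> \<le> C" for \<omega> using abs_Re_le_cmod[of "Z \<omega>"] bdd[of \<omega>] by linarith
    fix t
    have "complex_of_real (Re z) * w = (z * w + cnj z * w) / 2" for z w
      by (simp add: complex_add_cnj flip: distrib_right)
    then have "(CLINT \<omega>|M. Re (Z \<omega>) * iexp (t * X \<omega>))
       = (CLINT \<omega>|M. (Z \<omega> * iexp (t * X \<omega>) + cnj (Z \<omega>) * iexp (t * X \<omega>)) / 2)"
      by (simp only:)
    also have "\<dots> = 0" using i[of t] zero[of t] conj[of t] by simp
    finally show "(CLINT \<omega>|M. Re (Z \<omega>) * iexp (t * X \<omega>)) = 0" .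
  qed auto
  moreover have "expectation (\<lambda>\<omega>. Im (Z \<omega>) * indicator B (X \<omega>)) = 0"
  proof (rule fourier_zero_real[where C=C])
    show "\<bar>Im (Z \<omega>)\<bar> \<le> C" for \<omega> using abs_Im_le_cmod[of "Z \<omega>"] bdd[of \<omega>] by linarith
    fix t
    have "complex_of_real (Im z) * w = (z * w - cnj z * w) / (2 * \<i>)" for z w
      by (simp add: complex_eq_iff algebra_simps Re_divide Im_divide)
    then have "(CLINT \<omega>|M. Im (Z \<omega>) * iexp (t * X \<omega>))
       = (CLINT \<omega>|M. (Z \<omega> * iexp (t * X \<omega>) - cnj (Z \<omega>) * iexp (t * X \<omega>)) / (2 * \<i>))"
      by (simp only:)
    also have "\<dots> = 0" using i[of t] zero[of t] conj[of t] by simp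
    finally show "(CLINT \<omega>|M. Im (Z \<omega>) * iexp (t * X \<omega>)) = 0" .
  qed auto
  moreover have "integrable M (\<lambda>\<omega>. Z \<omega> * indicator B (X \<omega>))"
    using bdd order_trans[OF norm_ge_zero bdd]
    by (auto intro!: integrable_const_bound[where B=C] simp: indicator_def)
  moreover have "Re (indicator B x) = indicator B x" "Im (indicator B x) = 0" for x
    by (simp_all add: indicator_def)
  ultimately show ?thesis
    by (simp add: complex_eq_iff flip: integral_Re integral_Im)
qed

end

section \<open>Independence of the past and the future of the noise\<close>

lemma (in prob_space) centered_gaussian_char:
  assumes g: "gaussian_rv M X" and m: "has_bochner_integral M X 0"
  shows "(CLINT \<omega>|M. iexp (X \<omega>)) = exp (- complex_of_real (expectation (\<lambda>\<omega>. (X \<omega>)\<^sup>2)) / 2)"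
proof -
  have [measurable]: "X \<in> borel_measurable M" using g by (simp add: gaussian_rv_def)
  have EX: "expectation X = 0" using m by (simp add: has_bochner_integral_iff)
  from g consider \<mu> s where "s > 0" "distributed M lborel X (\<lambda>x. ennreal (normal_density \<mu> s x))"
    | \<mu> where "AE \<omega> in M. X \<omega> = \<mu>" unfolding gaussian_rv_def by blast
  then show ?thesis
  proof cases
    case 1
    have \<mu>: "\<mu> = 0" using normal_distributed_expectation[OF 1] EX by simp
    have s: "expectation (\<lambda>\<omega>. (X \<omega>)\<^sup>2) = s\<^sup>2" using normal_distributed_variance[OF 1] EX by simp
    have d: "distributed M lborel (\<lambda>\<omega>. X \<omega> / s) std_normal_density"
      using normal_standard_normal_convert[OF 1(1), of X \<mu>] 1(2) \<mu> by simp
    have "(CLINT \<omega>|M. iexp (X \<omega>)) = (CLINT x|distr M lborel (\<lambda>\<omega>. X \<omega> / s). iexp (s * x))"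
      using 1(1) by (subst integral_distr) auto
    also have "\<dots> = char std_normal_distribution s"
      using d by (simp add: char_def distributed_def)
    also have "\<dots> = exp (- complex_of_real (s\<^sup>2) / 2)"
      by (simp add: char_std_normal_distribution flip: exp_of_real)
    finally show ?thesis by (simp add: s)
  next
    case 2
    have "expectation X = expectation (\<lambda>_. \<mu>)"
      using 2 by (intro integral_cong_AE) auto
    then have \<mu>: "\<mu> = 0" using EX by (simp add: prob_space)
    have "expectation (\<lambda>\<omega>. (X \<omega>)\<^sup>2) = expectation (\<lambda>_. 0)"
      using 2 \<mu> by (intro integral_cong_AE) auto
    moreover have "(CLINT \<omega>|M. iexp (X \<omega>)) = (CLINT \<omega>|M. 1)"
      using 2 \<mu> by (intro integral_cong_AE) auto
    ultimately show ?thesis by (simp add: prob_space)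
  qed
qed

locale noise_space =
  fixes M :: "'a measure" and W :: "(real \<times> real) set \<Rightarrow> 'a \<Rightarrow> real"
  assumes white: "white_noise M W"

sublocale noise_space \<subseteq> prob_space M
  using white by (simp add: white_noise_def)

context noise_space begin

lemma noise_mean: "A \<in> noise_sets \<Longrightarrow> has_bochner_integral M (W A) 0"
  using white by (simp add: white_noise_def)

lemma noise_cov: "A \<in> noise_sets \<Longrightarrow> B \<in> noise_sets \<Longrightarrow>
    has_bochner_integral M (\<lambda>\<omega>. W A \<omega> * W B \<omega>) (measure spacetime (A \<inter> B))"
  using white by (simp add: white_noise_def)

lemma noise_measurable[measurable]: "A \<in> noise_sets \<Longrightarrow> W A \<in> borel_measurable M"
  using noise_mean by (auto simp: has_bochner_integral_iff)

text \<open>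
  White noise is specified by the Gaussianity of exactly these random variables; that they form a
  vector space is what makes the noise a jointly Gaussian family.
\<close>

definition noise_comb :: "(real \<times> real) set set \<Rightarrow> ('a \<Rightarrow> real) set" where
  "noise_comb S = {\<lambda>\<omega>. \<Sum>A\<in>F. c A * W A \<omega> | F c. finite F \<and> F \<subseteq> S}"

lemma noise_combI: "finite F \<Longrightarrow> F \<subseteq> S \<Longrightarrow> (\<lambda>\<omega>. \<Sum>A\<in>F. c A * W A \<omega>) \<in> noise_comb S"
  unfolding noise_comb_def by blast

lemma noise_comb_zero: "(\<lambda>_. 0) \<in> noise_comb S"
  using noise_combI[of "{}" S] by simp

lemma noise_comb_base: "A \<in> S \<Longrightarrow> W A \<in> noise_comb S"
  using noise_combI[of "{A}" S "\<lambda>_. 1"] by simp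

lemma noise_comb_scale:
  assumes "X \<in> noise_comb S" shows "(\<lambda>\<omega>. t * X \<omega>) \<in> noise_comb S"
proof -
  obtain F c where F: "finite F" "F \<subseteq> S" and X: "X = (\<lambda>\<omega>. \<Sum>A\<in>F. c A * W A \<omega>)"
    using assms unfolding noise_comb_def by blast
  show ?thesis
    using noise_combI[OF F, of "\<lambda>A. t * c A"] by (simp add: X sum_distrib_left mult.assoc)
qed

lemma noise_comb_add:
  assumes "X \<in> noise_comb S" "Y \<in> noise_comb S"
  shows "(\<lambda>\<omega>. X \<omega> + Y \<omega>) \<in> noise_comb S"
proof -
  obtain F c where F: "finite F" "F \<subseteq> S" and X: "X = (\<lambda>\<omega>. \<Sum>A\<in>F. c A * W A \<omega>)"
    using assms unfolding noise_comb_def by blast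
  obtain H d where H: "finite H" "H \<subseteq> S" and Y: "Y = (\<lambda>\<omega>. \<Sum>A\<in>H. d A * W A \<omega>)"
    using assms unfolding noise_comb_def by blast
  let ?e = "\<lambda>A. (if A \<in> F then c A else 0) + (if A \<in> H then d A else 0)"
  have "(\<Sum>A\<in>F \<union> H. ?e A * W A \<omega>) = X \<omega> + Y \<omega>" for \<omega>
  proof -
    have "(\<Sum>A\<in>F \<union> H. (if A \<in> F then c A else 0) * W A \<omega>) = X \<omega>"
      unfolding X using F H by (intro sum.mono_neutral_cong_right) auto
    moreover have "(\<Sum>A\<in>F \<union> H. (if A \<in> H then d A else 0) * W A \<omega>) = Y \<omega>"
      unfolding Y using F H by (intro sum.mono_neutral_cong_right) auto
    ultimately show ?thesis by (simp add: distrib_right sum.distrib)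
  qed
  then show ?thesis
    using noise_combI[of "F \<union> H" S ?e] F H by simp
qed

lemma noise_comb_mono: "S \<subseteq> T \<Longrightarrow> X \<in> noise_comb S \<Longrightarrow> X \<in> noise_comb T"
  unfolding noise_comb_def by blast

lemma noise_comb_mean:
  assumes "X \<in> noise_comb S" "S \<subseteq> noise_sets" shows "has_bochner_integral M X 0"
proof -
  obtain F c where F: "finite F" "F \<subseteq> S" and X: "X = (\<lambda>\<omega>. \<Sum>A\<in>F. c A * W A \<omega>)"
    using assms unfolding noise_comb_def by blast
  have "has_bochner_integral M X (\<Sum>A\<in>F. c A * 0)"
    unfolding X using F assms
    by (intro has_bochner_integral_sum has_bochner_integral_mult_right noise_mean) auto
  then show ?thesis by simp
qed

lemma noise_comb_cov:
  assumes "X \<in> noise_comb S" "Y \<in> noise_comb T" "S \<subseteq> noise_sets" "T \<subseteq> noise_sets"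
  shows "integrable M (\<lambda>\<omega>. X \<omega> * Y \<omega>)"
    and "(\<And>A B. A \<in> S \<Longrightarrow> B \<in> T \<Longrightarrow> A \<inter> B = {}) \<Longrightarrow> expectation (\<lambda>\<omega>. X \<omega> * Y \<omega>) = 0"
proof -
  obtain F c where F: "finite F" "F \<subseteq> S" and X: "X = (\<lambda>\<omega>. \<Sum>A\<in>F. c A * W A \<omega>)"
    using assms unfolding noise_comb_def by blast
  obtain H d where H: "finite H" "H \<subseteq> T" and Y: "Y = (\<lambda>\<omega>. \<Sum>A\<in>H. d A * W A \<omega>)"
    using assms unfolding noise_comb_def by blast
  have "has_bochner_integral M (\<lambda>\<omega>. \<Sum>A\<in>F. \<Sum>B\<in>H. (c A * d B) * (W A \<omega> * W B \<omega>))
      (\<Sum>A\<in>F. \<Sum>B\<in>H. (c A * d B) * measure spacetime (A \<inter> B))"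
    using F H assms
    by (intro has_bochner_integral_sum has_bochner_integral_mult_right noise_cov) auto
  also have "(\<lambda>\<omega>. \<Sum>A\<in>F. \<Sum>B\<in>H. (c A * d B) * (W A \<omega> * W B \<omega>)) = (\<lambda>\<omega>. X \<omega> * Y \<omega>)"
    by (simp add: X Y sum_product mult_ac)
  finally have *: "has_bochner_integral M (\<lambda>\<omega>. X \<omega> * Y \<omega>)
      (\<Sum>A\<in>F. \<Sum>B\<in>H. (c A * d B) * measure spacetime (A \<inter> B))" .
  show "integrable M (\<lambda>\<omega>. X \<omega> * Y \<omega>)" using * by (simp add: has_bochner_integral_iff)
  assume disj: "\<And>A B. A \<in> S \<Longrightarrow> B \<in> T \<Longrightarrow> A \<inter> B = {}"
  have "(\<Sum>A\<in>F. \<Sum>B\<in>H. (c A * d B) * measure spacetime (A \<inter> B)) = 0"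
    using F H disj by (intro sum.neutral ballI) (auto simp: subset_iff)
  with * show "expectation (\<lambda>\<omega>. X \<omega> * Y \<omega>) = 0" by (simp add: has_bochner_integral_iff)
qed

lemma noise_comb_char:
  assumes "X \<in> noise_comb noise_sets"
  shows "(CLINT \<omega>|M. iexp (X \<omega>)) = exp (- complex_of_real (expectation (\<lambda>\<omega>. (X \<omega>)\<^sup>2)) / 2)"
proof (rule centered_gaussian_char)
  show "gaussian_rv M X"
    using assms white unfolding noise_comb_def white_noise_def by blast
  show "has_bochner_integral M X 0" using noise_comb_mean[OF assms] by simp
qed

definition past :: "real \<Rightarrow> (real \<times> real) set set" where
  "past t = {A \<in> noise_sets. A \<subseteq> {0..t} \<times> UNIV}"

definition future :: "real \<Rightarrow> (real \<times> real) set set" where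
  "future t = {A \<in> noise_sets. A \<subseteq> {t<..} \<times> UNIV}"

lemma past_noise: "past t \<subseteq> noise_sets" and future_noise: "future t \<subseteq> noise_sets"
  by (auto simp: past_def future_def)

lemma past_future_disjoint: "A \<in> past t \<Longrightarrow> B \<in> future t \<Longrightarrow> A \<inter> B = {}"
  by (force simp: past_def future_def)

lemma noise_comb_measurable:
  "X \<in> noise_comb S \<Longrightarrow> S \<subseteq> noise_sets \<Longrightarrow> X \<in> borel_measurable M"
  using noise_comb_mean by (auto simp: has_bochner_integral_iff)

text \<open>
  Both sides are determined by variances, and the variance of the sum has no cross term because the
  two variables live on disjoint regions.
\<close>

lemma char_past_future:
  assumes V: "V \<in> noise_comb (past a)" and X: "X \<in> noise_comb (future a)"
  shows "(CLINT \<omega>|M. iexp (V \<omega> + X \<omega>)) = (CLINT \<omega>|M. iexp (V \<omega>)) * (CLINT \<omega>|M. iexp (X \<omega>))"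
proof -
  have V': "V \<in> noise_comb noise_sets" and X': "X \<in> noise_comb noise_sets"
    by (rule noise_comb_mono[OF past_noise V], rule noise_comb_mono[OF future_noise X])
  note i = noise_comb_cov(1)[OF V' V'] noise_comb_cov(1)[OF V' X'] noise_comb_cov(1)[OF X' X']
  have "expectation (\<lambda>\<omega>. (V \<omega> + X \<omega>)\<^sup>2)
      = expectation (\<lambda>\<omega>. V \<omega> * V \<omega> + 2 * (V \<omega> * X \<omega>) + X \<omega> * X \<omega>)"
    by (simp add: power2_eq_square algebra_simps)
  also have "\<dots> = expectation (\<lambda>\<omega>. V \<omega> * V \<omega>) + 2 * expectation (\<lambda>\<omega>. V \<omega> * X \<omega>)
      + expectation (\<lambda>\<omega>. X \<omega> * X \<omega>)"
    using i by simp
  also have "expectation (\<lambda>\<omega>. V \<omega> * X \<omega>) = 0"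
    by (rule noise_comb_cov(2)[OF V X past_noise future_noise past_future_disjoint])
  finally show ?thesis
    using noise_comb_char[OF noise_comb_add[OF V' X']] noise_comb_char[OF V'] noise_comb_char[OF X']
    by (simp add: power2_eq_square diff_divide_distrib flip: exp_add)
qed

text \<open>
  With constraints on sets in \<open>past a\<close>, these events are closed under intersection and, together
  with the null sets, generate the filtration at time \<open>a\<close>.
\<close>

definition cylinder :: "((real \<times> real) set \<times> real set) list \<Rightarrow> 'a set" where
  "cylinder L = {\<omega> \<in> space M. \<forall>(A, B) \<in> set L. W A \<omega> \<in> B}"

lemma cylinder_sets:
  assumes "set L \<subseteq> noise_sets \<times> sets borel" shows "cylinder L \<in> sets M"
  using assms
proof (induction L)
  case (Cons p L)
  obtain A B where p: "p = (A, B)" by (cases p)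
  have "cylinder (p # L) = (W A -` B \<inter> space M) \<inter> cylinder L"
    by (auto simp: cylinder_def p)
  moreover have "W A -` B \<inter> space M \<in> sets M"
    using Cons.prems p by (intro measurable_sets[OF noise_measurable]) auto
  ultimately show ?case using Cons by simp
qed (simp add: cylinder_def)

text \<open>
  Induction on the number of constraints, from exponentials to indicators.  Adding the constraint
  \<open>W A \<in> B\<close> is an application of \<open>fourier_zero\<close> to the variable \<open>W A\<close>; its hypothesis
  multiplies the integrand by \<open>exp (i t W A)\<close>, which is absorbed into the exponential of \<open>V\<close>.
  This is why \<open>V\<close> ranges over all linear combinations.
\<close>

lemma cylinder_fourier:
  assumes X: "X \<in> noise_comb (future a)" and L: "set L \<subseteq> past a \<times> sets borel"
    and V: "V \<in> noise_comb (past a)"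
  shows "(CLINT \<omega>|M. indicator (cylinder L) \<omega> * (iexp (V \<omega>) * (iexp (X \<omega>) - (CLINT \<omega>|M. iexp (X \<omega>))))) = 0"
    (is "(CLINT \<omega>|M. indicator _ \<omega> * (_ * (_ - ?c))) = 0")
  using L V
proof (induction L arbitrary: V)
  case Nil
  have [measurable]: "V \<in> borel_measurable M" "X \<in> borel_measurable M"
    using noise_comb_measurable[OF Nil(2) past_noise] noise_comb_measurable[OF X future_noise] .
  have i: "integrable M (\<lambda>\<omega>. iexp (V \<omega> + X \<omega>))" "integrable M (\<lambda>\<omega>. iexp (V \<omega>))"
    by (auto intro!: integrable_const_bound[where B=1] simp del: of_real_add)
  have "(CLINT \<omega>|M. indicator (cylinder []) \<omega> * (iexp (V \<omega>) * (iexp (X \<omega>) - ?c)))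
      = (CLINT \<omega>|M. iexp (V \<omega> + X \<omega>) - iexp (V \<omega>) * ?c)"
    by (intro Bochner_Integration.integral_cong) (auto simp: cylinder_def algebra_simps exp_add)
  also have "\<dots> = 0"
    using i char_past_future[OF Nil(2) X] by simp
  finally show ?case .
next
  case (Cons p L)
  obtain A B where p: "p = (A, B)" by (cases p)
  have A: "A \<in> past a" and B[measurable]: "B \<in> sets borel" using Cons.prems p by auto
  have [measurable]: "V \<in> borel_measurable M" "X \<in> borel_measurable M" "W A \<in> borel_measurable M"
    using noise_comb_measurable[OF Cons.prems(2) past_noise] noise_comb_measurable[OF X future_noise]
      noise_measurable[OF subsetD[OF past_noise A]] .
  have [measurable]: "cylinder L \<in> sets M"
    using Cons.prems past_noise by (intro cylinder_sets) auto
  let ?Z = "\<lambda>\<omega>. indicator (cylinder L) \<omega> * (iexp (V \<omega>) * (iexp (X \<omega>) - ?c))"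
  have "(CLINT \<omega>|M. ?Z \<omega> * indicator B (W A \<omega>)) = 0"
  proof (rule fourier_zero[where C="1 + norm ?c"])
    fix \<omega> show "norm (?Z \<omega>) \<le> 1 + norm ?c"
      using norm_triangle_ineq4[of "iexp (X \<omega>)" ?c] by (simp add: norm_mult indicator_def)
  next
    fix t
    have "(\<lambda>\<omega>. V \<omega> + t * W A \<omega>) \<in> noise_comb (past a)"
      using noise_comb_add[OF Cons.prems(2) noise_comb_scale[OF noise_comb_base[OF A]]] .
    from Cons.IH[OF _ this] Cons.prems(1)
    show "(CLINT \<omega>|M. ?Z \<omega> * iexp (t * W A \<omega>)) = 0"
      by (simp add: exp_add algebra_simps)
  qed auto
  moreover have "(CLINT \<omega>|M. indicator (cylinder (p # L)) \<omega> * (iexp (V \<omega>) * (iexp (X \<omega>) - ?c)))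
      = (CLINT \<omega>|M. ?Z \<omega> * indicator B (W A \<omega>))"
    by (intro Bochner_Integration.integral_cong) (auto simp: cylinder_def p indicator_def)
  ultimately show ?case by simp
qed

lemma prob_cylinder_Int:
  assumes X: "X \<in> noise_comb (future a)" and L: "set L \<subseteq> past a \<times> sets borel"
    and B[measurable]: "B \<in> sets borel"
  shows "prob (cylinder L \<inter> (X -` B \<inter> space M)) = prob (cylinder L) * prob (X -` B \<inter> space M)"
proof -
  have [measurable]: "X \<in> borel_measurable M" "cylinder L \<in> sets M"
    using noise_comb_measurable[OF X future_noise] cylinder_sets[of L] L past_noise by auto
  let ?p = "prob (cylinder L)"
  have i: "integrable M (\<lambda>\<omega>. indicator (cylinder L) \<omega> * iexp (t * X \<omega>))"
    "integrable M (\<lambda>\<omega>. iexp (t * X \<omega>))" "integrable M (\<lambda>\<omega>. indicator (cylinder L) \<omega> :: complex)" for t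
    by (auto intro!: integrable_const_bound[where B=1] simp: indicator_def simp del: of_real_mult)
  have "expectation (\<lambda>\<omega>. (indicator (cylinder L) \<omega> - ?p) * indicator B (X \<omega>)) = 0"
  proof (rule fourier_zero_real[where C=1])
    fix \<omega> show "\<bar>indicator (cylinder L) \<omega> - ?p\<bar> \<le> 1"
      by (auto simp: indicator_def)
  next
    fix t
    let ?c = "CLINT \<omega>|M. iexp (t * X \<omega>)"
    have "(CLINT \<omega>|M. indicator (cylinder L) \<omega> * (iexp 0 * (iexp (t * X \<omega>) - ?c))) = 0"
      using cylinder_fourier[OF noise_comb_scale[OF X] L noise_comb_zero] by simp
    moreover have "(CLINT \<omega>|M. indicator (cylinder L) \<omega>) = complex_of_real ?p"
      using integral_complex_of_real[of M "indicator (cylinder L)"] by (simp add: of_real_indicator)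
    ultimately have "(CLINT \<omega>|M. indicator (cylinder L) \<omega> * iexp (t * X \<omega>)) = ?p * ?c"
      using i by (simp add: right_diff_distrib)
    then show "(CLINT \<omega>|M. complex_of_real (indicator (cylinder L) \<omega> - ?p) * iexp (t * X \<omega>)) = 0"
      using i by (simp add: left_diff_distrib of_real_indicator)
  qed auto
  moreover have "integrable M (\<lambda>\<omega>. indicator (cylinder L) \<omega> * indicator B (X \<omega>) :: real)"
    "integrable M (\<lambda>\<omega>. indicator B (X \<omega>) :: real)"
    by (auto intro!: integrable_const_bound[where B=1] simp: indicator_def)
  moreover have "expectation (\<lambda>\<omega>. indicator (cylinder L) \<omega> * indicator B (X \<omega>)) = prob (cylinder L \<inter> (X -` B \<inter> space M))"
    by (subst Bochner_Integration.integral_cong[where g="indicator (cylinder L \<inter> (X -` B \<inter> space M))"])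
       (auto simp: indicator_def)
  moreover have "expectation (\<lambda>\<omega>. indicator B (X \<omega>)) = prob (X -` B \<inter> space M)"
    by (subst Bochner_Integration.integral_cong[where g="indicator (X -` B \<inter> space M)"])
       (auto simp: indicator_def)
  ultimately show ?thesis
    by (simp add: left_diff_distrib)
qed

lemma null_sets_subset_Pow: "null_sets M \<subseteq> Pow (space M)"
  using null_setsD2 sets.sets_into_space by blast

lemma sets_noise_filtration:
  "sets (noise_filtration M W t) = sigma_sets (space M)
     ({W A -` B \<inter> space M | A B. A \<in> past t \<and> B \<in> sets borel} \<union> null_sets M)"
proof -
  have "{W A -` B \<inter> space M | A B. A \<in> noise_sets \<and> A \<subseteq> {0..t} \<times> UNIV \<and> B \<in> sets borel}
      = {W A -` B \<inter> space M | A B. A \<in> past t \<and> B \<in> sets borel}"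
    by (auto simp: past_def)
  then show ?thesis
    unfolding noise_filtration_def
    by (subst sets_measure_of) (use null_sets_subset_Pow in auto)
qed

lemma space_noise_filtration: "space (noise_filtration M W t) = space M"
  unfolding noise_filtration_def
  by (subst space_measure_of) (use null_sets_subset_Pow in auto)

lemma noise_filtration_subset: "sets (noise_filtration M W t) \<subseteq> sets M"
  unfolding sets_noise_filtration
proof (rule sets.sigma_sets_subset, safe)
  fix A :: "(real \<times> real) set" and B :: "real set"
  assume "A \<in> past t" "B \<in> sets borel"
  then show "W A -` B \<inter> space M \<in> sets M"
    using past_noise by (intro measurable_sets[OF noise_measurable]) auto
qed auto

lemma past_mono: "s \<le> t \<Longrightarrow> past s \<subseteq> past t"
  by (force simp: past_def)

lemma noise_filtration_mono: "s \<le> t \<Longrightarrow> sets (noise_filtration M W s) \<subseteq> sets (noise_filtration M W t)"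
  unfolding sets_noise_filtration using past_mono[of s t] by (intro sigma_sets_mono') blast

lemma adapted_measurable: "Y \<in> borel_measurable (noise_filtration M W t) \<Longrightarrow> Y \<in> borel_measurable M"
  using noise_filtration_subset by (auto simp: measurable_def space_noise_filtration)

lemma adapted_mono: "s \<le> t \<Longrightarrow> Y \<in> borel_measurable (noise_filtration M W s) \<Longrightarrow>
    Y \<in> borel_measurable (noise_filtration M W t)"
  using noise_filtration_mono by (fastforce simp: measurable_def space_noise_filtration)

lemma noise_adapted:
  assumes "A \<in> past t" shows "W A \<in> borel_measurable (noise_filtration M W t)"
proof (rule measurableI)
  fix B :: "real set" assume "B \<in> sets borel"
  then show "W A -` B \<inter> space (noise_filtration M W t) \<in> sets (noise_filtration M W t)"
    using assms unfolding sets_noise_filtration space_noise_filtration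
    by (intro sigma_sets.Basic) auto
qed auto

text \<open>
  The generating events of the filtration are closed under intersection once null sets are
  included, and null sets are independent of everything.
\<close>

lemma indep_past_future:
  fixes X Y :: "'a \<Rightarrow> real"
  assumes Y: "Y \<in> borel_measurable (noise_filtration M W a)" and X: "X \<in> noise_comb (future a)"
  shows "indep_var borel Y borel X"
proof -
  have [measurable]: "X \<in> borel_measurable M" using noise_comb_measurable[OF X future_noise] .
  define \<G> where "\<G> = {cylinder L | L. set L \<subseteq> past a \<times> sets borel} \<union> null_sets M"
  define \<H> where "\<H> = {X -` B \<inter> space M | B. B \<in> sets borel}"
  have cyl: "cylinder L \<in> sets M" if "set L \<subseteq> past a \<times> sets borel" for L
    using that past_noise by (intro cylinder_sets) auto
  have "indep_set \<G> \<H>"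
    unfolding indep_sets2_eq
  proof (intro conjI ballI)
    show "\<G> \<subseteq> events" "\<H> \<subseteq> events" using cyl by (auto simp: \<G>_def \<H>_def)
    fix S T assume S: "S \<in> \<G>" and T: "T \<in> \<H>"
    from T obtain B where B: "B \<in> sets borel" "T = X -` B \<inter> space M" by (auto simp: \<H>_def)
    from S show "prob (S \<inter> T) = prob S * prob T"
      unfolding \<G>_def
    proof
      assume "S \<in> {cylinder L | L. set L \<subseteq> past a \<times> sets borel}"
      then show ?thesis using prob_cylinder_Int[OF X _ B(1)] B(2) by blast
    next
      assume S: "S \<in> null_sets M"
      then have "S \<inter> T \<in> null_sets M" using B by (intro null_set_Int2) auto
      with S show ?thesis by (simp add: measure_def null_setsD1)
    qed
  qed
  moreover have "Int_stable \<G>"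
  proof (rule Int_stableI)
    fix S T assume S: "S \<in> \<G>" and T: "T \<in> \<G>"
    then have ST: "S \<in> sets M" "T \<in> sets M" using cyl by (auto simp: \<G>_def)
    show "S \<inter> T \<in> \<G>"
    proof (cases "S \<in> null_sets M \<or> T \<in> null_sets M")
      case True
      then have "S \<inter> T \<in> null_sets M" using ST by (auto intro: null_set_Int1 null_set_Int2)
      then show ?thesis by (simp add: \<G>_def)
    next
      case False
      then obtain L L' where "S = cylinder L" "T = cylinder L'"
        "set L \<subseteq> past a \<times> sets borel" "set L' \<subseteq> past a \<times> sets borel"
        using S T by (auto simp: \<G>_def)
      then have "S \<inter> T = cylinder (L @ L')" "set (L @ L') \<subseteq> past a \<times> sets borel"
        by (auto simp: cylinder_def)
      then show ?thesis unfolding \<G>_def by blast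
    qed
  qed
  moreover have "Int_stable \<H>"
  proof (rule Int_stableI)
    fix S T assume "S \<in> \<H>" "T \<in> \<H>"
    then obtain B B' where "B \<in> sets borel" "B' \<in> sets borel" "S = X -` B \<inter> space M" "T = X -` B' \<inter> space M"
      by (auto simp: \<H>_def)
    then show "S \<inter> T \<in> \<H>"
      unfolding \<H>_def by (intro CollectI exI[of _ "B \<inter> B'"]) auto
  qed
  ultimately have ind: "indep_set (sigma_sets (space M) \<G>) (sigma_sets (space M) \<H>)"
    by (rule indep_set_sigma_sets)
  have "sets (noise_filtration M W a) \<subseteq> sigma_sets (space M) \<G>"
    unfolding sets_noise_filtration
  proof (rule sigma_sets_mono', safe)
    fix A :: "(real \<times> real) set" and B :: "real set" assume "A \<in> past a" "B \<in> sets borel"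
    moreover have "W A -` B \<inter> space M = cylinder [(A, B)]" by (auto simp: cylinder_def)
    ultimately show "W A -` B \<inter> space M \<in> \<G>"
      unfolding \<G>_def by (intro UnI1 CollectI exI[of _ "[(A, B)]"]) auto
  qed (auto simp: \<G>_def)
  then have "{Y -` B \<inter> space M | B. B \<in> sets borel} \<subseteq> sigma_sets (space M) \<G>"
    using measurable_sets[OF Y] by (auto simp: space_noise_filtration)
  moreover have "\<G> \<subseteq> Pow (space M)" using cyl by (auto simp: \<G>_def dest: sets.sets_into_space)
  ultimately have "sigma_sets (space M) {Y -` B \<inter> space M | B. B \<in> sets borel} \<subseteq> sigma_sets (space M) \<G>"
    by (intro sigma_sets_mono)
  then show ?thesis
    using ind adapted_measurable[OF Y] unfolding indep_var_eq \<H>_def[symmetric] indep_sets2_eq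
    by auto
qed

lemma past_times_future:
  assumes U: "U \<in> borel_measurable (noise_filtration M W a)" "integrable M U"
    and X: "X \<in> noise_comb (future a)"
  shows "has_bochner_integral M (\<lambda>\<omega>. U \<omega> * X \<omega>) 0"
  using indep_var_integrable[OF indep_past_future[OF U(1) X] U(2)]
    indep_var_lebesgue_integral[OF indep_past_future[OF U(1) X] U(2)]
    noise_comb_mean[OF X future_noise]
  by (simp add: has_bochner_integral_iff)

text \<open>
  Independence is available for a single linear combination of future noise, which handles squares;
  products follow by polarisation.
\<close>

lemma past_times_future_product:
  assumes U: "U \<in> borel_measurable (noise_filtration M W a)" "integrable M U"
    and X: "X \<in> noise_comb (future a)" and Y: "Y \<in> noise_comb (future a)"
  shows "has_bochner_integral M (\<lambda>\<omega>. U \<omega> * (X \<omega> * Y \<omega>)) (expectation U * expectation (\<lambda>\<omega>. X \<omega> * Y \<omega>))"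
proof -
  have sq: "has_bochner_integral M (\<lambda>\<omega>. U \<omega> * (V \<omega>)\<^sup>2) (expectation U * expectation (\<lambda>\<omega>. (V \<omega>)\<^sup>2))"
    and int: "integrable M (\<lambda>\<omega>. (V \<omega>)\<^sup>2)"
    if V: "V \<in> noise_comb (future a)" for V
  proof -
    have "indep_var borel ((\<lambda>x. x) \<circ> U) borel ((\<lambda>x. x\<^sup>2) \<circ> V)"
      by (rule indep_var_compose[OF indep_past_future[OF U(1) V]]) auto
    then have ind: "indep_var borel U borel (\<lambda>\<omega>. (V \<omega>)\<^sup>2)" by (simp add: comp_def)
    show int: "integrable M (\<lambda>\<omega>. (V \<omega>)\<^sup>2)"
      using noise_comb_cov(1)[OF V V future_noise future_noise] by (simp add: power2_eq_square)
    show "has_bochner_integral M (\<lambda>\<omega>. U \<omega> * (V \<omega>)\<^sup>2) (expectation U * expectation (\<lambda>\<omega>. (V \<omega>)\<^sup>2))"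
      using indep_var_integrable[OF ind U(2) int] indep_var_lebesgue_integral[OF ind U(2) int]
      by (simp add: has_bochner_integral_iff)
  qed
  have XY: "(\<lambda>\<omega>. X \<omega> + Y \<omega>) \<in> noise_comb (future a)" by (rule noise_comb_add[OF X Y])
  \<comment> \<open>Polarisation.\<close>
  have pol: "x * y = ((x + y)\<^sup>2 - x\<^sup>2 - y\<^sup>2) / 2" for x y :: real
    by (simp add: power2_eq_square algebra_simps)
  have e: "expectation (\<lambda>\<omega>. X \<omega> * Y \<omega>)
      = (expectation (\<lambda>\<omega>. (X \<omega> + Y \<omega>)\<^sup>2) - expectation (\<lambda>\<omega>. (X \<omega>)\<^sup>2) - expectation (\<lambda>\<omega>. (Y \<omega>)\<^sup>2)) / 2"
    unfolding pol using int[OF X] int[OF Y] int[OF XY] by simp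
  have "has_bochner_integral M (\<lambda>\<omega>. (U \<omega> * (X \<omega> + Y \<omega>)\<^sup>2 - U \<omega> * (X \<omega>)\<^sup>2 - U \<omega> * (Y \<omega>)\<^sup>2) / 2)
    ((expectation U * expectation (\<lambda>\<omega>. (X \<omega> + Y \<omega>)\<^sup>2) - expectation U * expectation (\<lambda>\<omega>. (X \<omega>)\<^sup>2)
      - expectation U * expectation (\<lambda>\<omega>. (Y \<omega>)\<^sup>2)) / 2)"
    by (intro has_bochner_integral_divide_zero has_bochner_integral_diff sq X Y XY)
  also have "(\<lambda>\<omega>. (U \<omega> * (X \<omega> + Y \<omega>)\<^sup>2 - U \<omega> * (X \<omega>)\<^sup>2 - U \<omega> * (Y \<omega>)\<^sup>2) / 2)
      = (\<lambda>\<omega>. U \<omega> * (X \<omega> * Y \<omega>))"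
    by (simp add: fun_eq_iff power2_eq_square algebra_simps)
  finally show ?thesis
    unfolding e by (simp add: right_diff_distrib)
qed

end

section \<open>The Walsh isometry\<close>

lemma sets_spacetime: "S \<in> sets spacetime \<longleftrightarrow> S \<in> sets borel \<and> S \<subseteq> {0..} \<times> UNIV"
  unfolding spacetime_def
  by (subst sets_restrict_space_iff) (auto intro!: borel_closed closed_Times)

lemma space_spacetime: "space spacetime = {0..} \<times> UNIV"
  by (simp add: spacetime_def space_restrict_space)

lemma emeasure_spacetime: "S \<in> sets spacetime \<Longrightarrow> emeasure spacetime S = emeasure lborel S"
  unfolding spacetime_def
  by (subst emeasure_restrict_space)
     (auto simp: sets_spacetime[unfolded spacetime_def] intro!: borel_closed closed_Times)

lemma nn_integral_spacetime:
  "(\<integral>\<^sup>+z. f z \<partial>spacetime) = (\<integral>\<^sup>+z. f z * indicator ({0..} \<times> UNIV) z \<partial>lborel)"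
  unfolding spacetime_def
  by (rule nn_integral_restrict_space) (auto intro!: borel_closed closed_Times)

lemma sigma_finite_spacetime: "sigma_finite_measure spacetime"
  unfolding spacetime_def
  by (rule sigma_finite_measure_restrict_space[OF lborel.sigma_finite_measure_axioms])
     (auto intro!: borel_closed closed_Times)

lemma slab_noise_sets:
  assumes "0 \<le> a" "A \<in> sets borel" "emeasure lborel A < \<infinity>"
  shows "{a<..b} \<times> A \<in> noise_sets"
proof -
  have s: "{a<..b} \<times> A \<in> sets spacetime"
    using assms by (auto simp: sets_spacetime intro!: borel_Times)
  have "emeasure spacetime ({a<..b} \<times> A) = emeasure (lborel \<Otimes>\<^sub>M lborel) ({a<..b} \<times> A)"
    using s by (simp add: emeasure_spacetime lborel_prod)
  also have "\<dots> = emeasure lborel {a<..b} * emeasure lborel A"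
    using assms by (subst lborel.emeasure_pair_measure_Times) auto
  also have "\<dots> < \<infinity>"
    using assms by (cases "a \<le> b") (auto simp: ennreal_mult_less_top)
  finally show ?thesis using s by (simp add: noise_sets_def)
qed

lemma has_bochner_integral_product:
  fixes f :: "'b \<Rightarrow> real" and g :: "'c \<Rightarrow> real"
  assumes "sigma_finite_measure M" "sigma_finite_measure N"
    and f: "has_bochner_integral M f a" and g: "has_bochner_integral N g b"
  shows "has_bochner_integral (M \<Otimes>\<^sub>M N) (\<lambda>(x, y). f x * g y) (a * b)"
proof -
  interpret M: sigma_finite_measure M by fact
  interpret N: sigma_finite_measure N by fact
  interpret pair_sigma_finite M N ..
  have fg: "integrable M f" "integrable N g" "integral\<^sup>L M f = a" "integral\<^sup>L N g = b"
    using f g by (auto simp: has_bochner_integral_iff)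
  have [measurable]: "f \<in> borel_measurable M" "g \<in> borel_measurable N" using fg by auto
  have i: "integrable (M \<Otimes>\<^sub>M N) (\<lambda>(x, y). f x * g y)"
    using fg by (intro Fubini_integrable) (auto simp: abs_mult)
  have "(\<integral>z. (case z of (x, y) \<Rightarrow> f x * g y) \<partial>(M \<Otimes>\<^sub>M N)) = (\<integral>x. (\<integral>y. f x * g y \<partial>N) \<partial>M)"
    using integral_fst'[OF i] by simp
  also have "\<dots> = a * b" using fg by simp
  finally show ?thesis using i by (simp add: has_bochner_integral_iff)
qed

text \<open>
  The Cauchy-Schwarz inequality for real functions, in a form that allows infinite norms.
\<close>

lemma nn_integral_abs_mult_le:
  fixes f g :: "'b \<Rightarrow> real"
  assumes [measurable]: "f \<in> borel_measurable M" "g \<in> borel_measurable M"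
  shows "(\<integral>\<^sup>+x. ennreal \<bar>f x * g x\<bar> \<partial>M)\<^sup>2 \<le> (\<integral>\<^sup>+x. ennreal ((f x)\<^sup>2) \<partial>M) * (\<integral>\<^sup>+x. ennreal ((g x)\<^sup>2) \<partial>M)"
  using Cauchy_Schwarz_nn_integral[of "\<lambda>x. ennreal \<bar>f x\<bar>" M "\<lambda>x. ennreal \<bar>g x\<bar>"]
  by (simp add: abs_mult ennreal_mult ennreal_power)

lemma L2_integrable_mult:
  fixes f g :: "'b \<Rightarrow> real"
  assumes [measurable]: "f \<in> borel_measurable M" "g \<in> borel_measurable M"
    and f: "(\<integral>\<^sup>+x. ennreal ((f x)\<^sup>2) \<partial>M) < \<infinity>" and g: "(\<integral>\<^sup>+x. ennreal ((g x)\<^sup>2) \<partial>M) < \<infinity>"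
  shows "integrable M (\<lambda>x. f x * g x)"
proof (rule integrableI_bounded)
  have "(\<integral>\<^sup>+x. ennreal \<bar>f x * g x\<bar> \<partial>M)\<^sup>2 < \<infinity>"
    by (rule le_less_trans[OF nn_integral_abs_mult_le]) (use f g in \<open>auto simp: ennreal_mult_less_top\<close>)
  then show "(\<integral>\<^sup>+x. ennreal (norm (f x * g x)) \<partial>M) < \<infinity>"
    by (simp add: power2_eq_square ennreal_mult_less_top) (auto simp: less_top)
qed auto

lemma L2_inner_tendsto_zero:
  fixes f g :: "nat \<Rightarrow> 'b \<Rightarrow> real"
  assumes [measurable]: "\<And>n. f n \<in> borel_measurable M" "\<And>n. g n \<in> borel_measurable M"
    and f: "(\<lambda>n. \<integral>\<^sup>+x. ennreal ((f n x)\<^sup>2) \<partial>M) \<longlonglongrightarrow> 0"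
    and g: "(\<lambda>n. \<integral>\<^sup>+x. ennreal ((g n x)\<^sup>2) \<partial>M) \<longlonglongrightarrow> c" and c: "c < \<infinity>"
  shows "(\<lambda>n. \<integral>\<^sup>+x. ennreal \<bar>f n x * g n x\<bar> \<partial>M) \<longlonglongrightarrow> 0"
proof -
  let ?u = "\<lambda>n. \<integral>\<^sup>+x. ennreal \<bar>f n x * g n x\<bar> \<partial>M"
  have *: "(\<lambda>n. (\<integral>\<^sup>+x. ennreal ((f n x)\<^sup>2) \<partial>M) * (\<integral>\<^sup>+x. ennreal ((g n x)\<^sup>2) \<partial>M)) \<longlonglongrightarrow> 0"
    using tendsto_mult_ennreal[OF f g] c by simp
  have sq: "(\<lambda>n. (?u n)\<^sup>2) \<longlonglongrightarrow> 0"
    by (rule tendsto_sandwich[OF _ _ tendsto_const *])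
       (auto intro!: always_eventually nn_integral_abs_mult_le)
  show ?thesis
  proof (rule order_tendstoI)
    fix e :: ennreal assume "0 < e"
    then have "0 < e\<^sup>2" by (simp add: power2_eq_square ennreal_zero_less_mult_iff)
    with order_tendstoD(2)[OF sq] have "\<forall>\<^sub>F n in sequentially. (?u n)\<^sup>2 < e\<^sup>2" by blast
    then show "\<forall>\<^sub>F n in sequentially. ?u n < e"
      by eventually_elim (meson not_le power_mono zero_le)
  qed simp
qed

text \<open>
  Continuity of the inner product.  It is used on \<open>L\<^sup>2(\<Omega>)\<close> and on
  \<open>L\<^sup>2(\<real>\<^sub>+ \<times> \<real> \<times> \<Omega>)\<close> with the same numbers \<open>r n\<close>, so that the two limits must agree.
\<close>

lemma L2_inner_tendsto:
  fixes f g :: "nat \<Rightarrow> 'b \<Rightarrow> real" and F H :: "'b \<Rightarrow> real"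
  assumes [measurable]: "\<And>n. f n \<in> borel_measurable M" "\<And>n. g n \<in> borel_measurable M"
      "F \<in> borel_measurable M" "H \<in> borel_measurable M"
    and F: "(\<integral>\<^sup>+x. ennreal ((F x)\<^sup>2) \<partial>M) < \<infinity>" and H: "(\<integral>\<^sup>+x. ennreal ((H x)\<^sup>2) \<partial>M) < \<infinity>"
    and f: "(\<lambda>n. \<integral>\<^sup>+x. ennreal ((f n x - F x)\<^sup>2) \<partial>M) \<longlonglongrightarrow> 0"
    and g: "(\<lambda>n. \<integral>\<^sup>+x. ennreal ((g n x - H x)\<^sup>2) \<partial>M) \<longlonglongrightarrow> 0"
    and i: "\<And>n. has_bochner_integral M (\<lambda>x. f n x * g n x) (r n)"
  shows "r \<longlonglongrightarrow> (\<integral>x. F x * H x \<partial>M)"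
proof -
  have iFH: "integrable M (\<lambda>x. F x * H x)" by (rule L2_integrable_mult) (use F H in auto)
  let ?e = "\<lambda>n. (\<integral>\<^sup>+x. ennreal \<bar>(f n x - F x) * (g n x - H x)\<bar> \<partial>M)
      + (\<integral>\<^sup>+x. ennreal \<bar>(f n x - F x) * H x\<bar> \<partial>M) + (\<integral>\<^sup>+x. ennreal \<bar>(g n x - H x) * F x\<bar> \<partial>M)"
  \<comment> \<open>The error splits as
    \<open>f g - F H = (f - F)(g - H) + (f - F) H + (g - H) F\<close>.\<close>
  have "?e \<longlonglongrightarrow> 0 + 0 + 0"
    by (intro tendsto_add L2_inner_tendsto_zero[OF _ _ f g] L2_inner_tendsto_zero[OF _ _ f tendsto_const H]
          L2_inner_tendsto_zero[OF _ _ g tendsto_const F]) auto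
  then have e: "?e \<longlonglongrightarrow> 0" by simp
  have le: "ennreal \<bar>r n - (\<integral>x. F x * H x \<partial>M)\<bar> \<le> ?e n" for n
  proof -
    have fg: "integrable M (\<lambda>x. f n x * g n x)" "(\<integral>x. f n x * g n x \<partial>M) = r n"
      using i[of n] by (auto simp: has_bochner_integral_iff)
    have "ennreal \<bar>r n - (\<integral>x. F x * H x \<partial>M)\<bar> = ennreal (norm (\<integral>x. f n x * g n x - F x * H x \<partial>M))"
      using fg iFH by simp
    also have "\<dots> \<le> (\<integral>\<^sup>+x. ennreal (norm (f n x * g n x - F x * H x)) \<partial>M)"
      using fg iFH by (intro integral_norm_bound_ennreal) auto
    also have "\<dots> \<le> (\<integral>\<^sup>+x. ennreal \<bar>(f n x - F x) * (g n x - H x)\<bar> + ennreal \<bar>(f n x - F x) * H x\<bar>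
        + ennreal \<bar>(g n x - H x) * F x\<bar> \<partial>M)"
    proof (rule nn_integral_mono)
      fix x
      have "f n x * g n x - F x * H x
          = (f n x - F x) * (g n x - H x) + (f n x - F x) * H x + (g n x - H x) * F x"
        by (simp add: algebra_simps)
      then have "norm (f n x * g n x - F x * H x)
          \<le> \<bar>(f n x - F x) * (g n x - H x)\<bar> + \<bar>(f n x - F x) * H x\<bar> + \<bar>(g n x - H x) * F x\<bar>"
        by simp
      then show "ennreal (norm (f n x * g n x - F x * H x)) \<le> ennreal \<bar>(f n x - F x) * (g n x - H x)\<bar>
          + ennreal \<bar>(f n x - F x) * H x\<bar> + ennreal \<bar>(g n x - H x) * F x\<bar>"
        by (simp del: real_norm_def flip: ennreal_plus)
    qed
    also have "\<dots> = ?e n" by (simp add: nn_integral_add)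
    finally show ?thesis .
  qed
  have "(\<lambda>n. ennreal \<bar>r n - (\<integral>x. F x * H x \<partial>M)\<bar>) \<longlonglongrightarrow> 0"
    by (rule tendsto_sandwich[OF _ _ tendsto_const e]) (use le in \<open>auto intro!: always_eventually\<close>)
  then have "(\<lambda>n. \<bar>r n - (\<integral>x. F x * H x \<partial>M)\<bar>) \<longlonglongrightarrow> 0"
    by (simp add: ennreal_tendsto_0_iff)
  then show ?thesis
    by (simp add: LIM_zero_iff tendsto_rabs_zero_iff)
qed

context noise_space begin

text \<open>
  The defect of additivity has second moment zero, by expanding the square.
\<close>

lemma noise_additive:
  assumes A: "A \<in> noise_sets" and B: "B \<in> noise_sets" and disj: "A \<inter> B = {}"
  shows "AE \<omega> in M. W (A \<union> B) \<omega> = W A \<omega> + W B \<omega>"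
proof -
  have AB: "A \<union> B \<in> noise_sets"
    using A B emeasure_subadditive[of A spacetime B]
    by (auto simp: noise_sets_def intro!: le_less_trans[OF emeasure_subadditive])
  let ?m = "measure spacetime"
  have m: "?m (A \<union> B) = ?m A + ?m B"
    using A B disj by (intro measure_Union) (auto simp: noise_sets_def)
  note c = noise_cov[OF AB AB] noise_cov[OF A A] noise_cov[OF B B]
    noise_cov[OF AB A] noise_cov[OF AB B] noise_cov[OF A B]
  let ?D = "\<lambda>\<omega>. W (A \<union> B) \<omega> - W A \<omega> - W B \<omega>"
  let ?P = "\<lambda>A B \<omega>. W A \<omega> * W B \<omega>"
  have "has_bochner_integral M (\<lambda>\<omega>. ?P (A \<union> B) (A \<union> B) \<omega> + ?P A A \<omega> + ?P B B \<omega>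
      - 2 * ?P (A \<union> B) A \<omega> - 2 * ?P (A \<union> B) B \<omega> + 2 * ?P A B \<omega>)
     (?m ((A \<union> B) \<inter> (A \<union> B)) + ?m (A \<inter> A) + ?m (B \<inter> B) - 2 * ?m ((A \<union> B) \<inter> A)
      - 2 * ?m ((A \<union> B) \<inter> B) + 2 * ?m (A \<inter> B))"
    by (intro has_bochner_integral_add has_bochner_integral_diff has_bochner_integral_mult_right c)
  also have "(\<lambda>\<omega>. ?P (A \<union> B) (A \<union> B) \<omega> + ?P A A \<omega> + ?P B B \<omega>
      - 2 * ?P (A \<union> B) A \<omega> - 2 * ?P (A \<union> B) B \<omega> + 2 * ?P A B \<omega>) = (\<lambda>\<omega>. (?D \<omega>)\<^sup>2)"
    by (auto simp: power2_eq_square algebra_simps)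
  finally have "has_bochner_integral M (\<lambda>\<omega>. (?D \<omega>)\<^sup>2) 0"
    by (simp add: m disj Int_absorb1)
  then have "AE \<omega> in M. (?D \<omega>)\<^sup>2 = 0"
    using integral_nonneg_eq_0_iff_AE[of M "\<lambda>\<omega>. (?D \<omega>)\<^sup>2"] by (simp add: has_bochner_integral_iff)
  then show ?thesis by eventually_elim simp
qed

abbreviation elementary :: "real \<Rightarrow> real \<Rightarrow> real set \<Rightarrow> ('a \<Rightarrow> real) \<Rightarrow> bool" where
  "elementary a b A Y \<equiv> 0 \<le> a \<and> a < b \<and> A \<in> sets borel \<and> emeasure lborel A < \<infinity> \<and>
     Y \<in> borel_measurable (noise_filtration M W a) \<and> (\<exists>C. \<forall>\<omega>\<in>space M. \<bar>Y \<omega>\<bar> \<le> C)"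

lemma bounded_mult_integrable:
  assumes [measurable]: "Y \<in> borel_measurable M" and C: "\<forall>\<omega>\<in>space M. \<bar>Y \<omega>\<bar> \<le> C" and X: "integrable M X"
  shows "integrable M (\<lambda>\<omega>. Y \<omega> * X \<omega> :: real)"
proof (rule Bochner_Integration.integrable_bound)
  show "integrable M (\<lambda>\<omega>. C * X \<omega>)" using X by simp
  show "(\<lambda>\<omega>. Y \<omega> * X \<omega>) \<in> borel_measurable M" using X by auto
  show "AE \<omega> in M. norm (Y \<omega> * X \<omega>) \<le> norm (C * X \<omega>)"
    using C by (intro AE_I2) (force simp: abs_mult intro!: mult_right_mono)
qed

text \<open>
  Cut the earlier slab \<open>S\<close> at the time \<open>a'\<close> where the later one starts.  The piece before
  \<open>a'\<close> joins \<open>Y\<close> and \<open>Y'\<close> as a factor known at time \<open>a'\<close> and contributes nothing,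
  since \<open>W S'\<close> is centered and independent of it.  The piece after \<open>a'\<close> is independent of
  \<open>Y Y'\<close> and contributes its covariance with \<open>W S'\<close>.
\<close>

lemma elementary_isometry_ordered:
  assumes e: "elementary a b A Y" and e': "elementary a' b' A' Y'" and le: "a \<le> a'"
  defines "S \<equiv> {a<..b} \<times> A" and "S' \<equiv> {a'<..b'} \<times> A'"
  shows "has_bochner_integral M (\<lambda>\<omega>. (Y \<omega> * W S \<omega>) * (Y' \<omega> * W S' \<omega>))
           (measure spacetime (S \<inter> S') * expectation (\<lambda>\<omega>. Y \<omega> * Y' \<omega>))"
proof -
  define S1 where "S1 = {a<..min b a'} \<times> A"
  define S2 where "S2 = {a'<..b} \<times> A"
  have n: "S1 \<in> noise_sets" "S2 \<in> noise_sets" "S \<in> noise_sets" "S' \<in> noise_sets"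
    using e e' by (auto simp: S_def S'_def S1_def S2_def intro!: slab_noise_sets)
  have S1: "S1 \<in> past a'" and S2: "S2 \<in> future a'" and S': "S' \<in> future a'"
    using n e e' by (auto simp: past_def future_def S_def S'_def S1_def S2_def)
  have "S1 \<union> S2 = S" "S1 \<inter> S2 = {}" "S \<inter> S' = S2 \<inter> S'"
    using le by (auto simp: S_def S'_def S1_def S2_def)
  note add = noise_additive[OF n(1,2) this(2), unfolded this(1)] and SS = this(3)
  have [measurable]: "Y \<in> borel_measurable M" "Y' \<in> borel_measurable M"
    using e e' adapted_measurable by auto
  note [measurable] = noise_measurable[OF n(1)] noise_measurable[OF n(2)]
    noise_measurable[OF n(3)] noise_measurable[OF n(4)]
  obtain C C' where C: "\<forall>\<omega>\<in>space M. \<bar>Y \<omega>\<bar> \<le> C" and C': "\<forall>\<omega>\<in>space M. \<bar>Y' \<omega>\<bar> \<le> C'"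
    using e e' by auto
  have ad: "Y \<in> borel_measurable (noise_filtration M W a')" "Y' \<in> borel_measurable (noise_filtration M W a')"
    using e e' adapted_mono[OF le] by auto
  have "integrable M (\<lambda>\<omega>. Y \<omega> * (Y' \<omega> * W S1 \<omega>))"
    using noise_mean[OF n(1)] C C'
    by (intro bounded_mult_integrable) (auto simp: has_bochner_integral_iff)
  moreover have "(\<lambda>\<omega>. Y \<omega> * (Y' \<omega> * W S1 \<omega>)) \<in> borel_measurable (noise_filtration M W a')"
    using ad noise_adapted[OF S1] by measurable
  ultimately have 1: "has_bochner_integral M (\<lambda>\<omega>. (Y \<omega> * (Y' \<omega> * W S1 \<omega>)) * W S' \<omega>) 0"
    using S' by (intro past_times_future[where a=a'] noise_comb_base)
  have "integrable M (\<lambda>\<omega>. Y \<omega> * (Y' \<omega> * 1))"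
    using C C' by (intro bounded_mult_integrable) auto
  moreover have "(\<lambda>\<omega>. Y \<omega> * Y' \<omega>) \<in> borel_measurable (noise_filtration M W a')"
    using ad by measurable
  ultimately have 2: "has_bochner_integral M (\<lambda>\<omega>. (Y \<omega> * Y' \<omega>) * (W S2 \<omega> * W S' \<omega>))
     (expectation (\<lambda>\<omega>. Y \<omega> * Y' \<omega>) * expectation (\<lambda>\<omega>. W S2 \<omega> * W S' \<omega>))"
    using S2 S' by (intro past_times_future_product[where a=a'] noise_comb_base) simp_all
  have "expectation (\<lambda>\<omega>. W S2 \<omega> * W S' \<omega>) = measure spacetime (S \<inter> S')"
    using noise_cov[OF n(2,4)] SS by (simp add: has_bochner_integral_iff)
  with has_bochner_integral_add[OF 1 2]
  have "has_bochner_integral M (\<lambda>\<omega>. (Y \<omega> * (Y' \<omega> * W S1 \<omega>)) * W S' \<omega> + (Y \<omega> * Y' \<omega>) * (W S2 \<omega> * W S' \<omega>))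
     (measure spacetime (S \<inter> S') * expectation (\<lambda>\<omega>. Y \<omega> * Y' \<omega>))"
    by (simp add: mult.commute)
  then show ?thesis
  proof (subst has_bochner_integral_cong_AE)
    show "AE \<omega> in M. Y \<omega> * W S \<omega> * (Y' \<omega> * W S' \<omega>)
        = (Y \<omega> * (Y' \<omega> * W S1 \<omega>)) * W S' \<omega> + (Y \<omega> * Y' \<omega>) * (W S2 \<omega> * W S' \<omega>)"
      using add by eventually_elim (simp add: algebra_simps)
  qed auto
qed

lemma elementary_isometry:
  assumes e: "elementary a b A Y" and e': "elementary a' b' A' Y'"
  defines "S \<equiv> {a<..b} \<times> A" and "S' \<equiv> {a'<..b'} \<times> A'"
  shows "has_bochner_integral M (\<lambda>\<omega>. (Y \<omega> * W S \<omega>) * (Y' \<omega> * W S' \<omega>))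
           (measure spacetime (S \<inter> S') * expectation (\<lambda>\<omega>. Y \<omega> * Y' \<omega>))"
proof (cases "a \<le> a'")
  case True
  from elementary_isometry_ordered[OF e e' True] show ?thesis by (simp add: S_def S'_def)
next
  case False
  then have "a' \<le> a" by simp
  from elementary_isometry_ordered[OF e' e this] show ?thesis
    by (simp add: S_def S'_def mult_ac Int_commute)
qed

lemma elementary_field:
  assumes e: "elementary a b A Y" and e': "elementary a' b' A' Y'"
  defines "S \<equiv> {a<..b} \<times> A" and "S' \<equiv> {a'<..b'} \<times> A'"
  shows "has_bochner_integral (spacetime \<Otimes>\<^sub>M M) (\<lambda>(z, \<omega>). (Y \<omega> * indicator S z) * (Y' \<omega> * indicator S' z))
           (measure spacetime (S \<inter> S') * expectation (\<lambda>\<omega>. Y \<omega> * Y' \<omega>))"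
proof -
  have n: "S \<in> noise_sets" "S' \<in> noise_sets"
    using e e' by (auto simp: S_def S'_def intro!: slab_noise_sets)
  have [measurable]: "Y \<in> borel_measurable M" "Y' \<in> borel_measurable M"
    using e e' adapted_measurable by auto
  obtain C C' where C: "\<forall>\<omega>\<in>space M. \<bar>Y \<omega>\<bar> \<le> C" and C': "\<forall>\<omega>\<in>space M. \<bar>Y' \<omega>\<bar> \<le> C'"
    using e e' by auto
  have "integrable M (\<lambda>\<omega>. Y \<omega> * (Y' \<omega> * 1))"
    using C C' by (intro bounded_mult_integrable) auto
  then have Y: "has_bochner_integral M (\<lambda>\<omega>. Y \<omega> * Y' \<omega>) (expectation (\<lambda>\<omega>. Y \<omega> * Y' \<omega>))"
    by (simp add: has_bochner_integral_iff)
  have "emeasure spacetime (S \<inter> S') < \<infinity>"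
    using n emeasure_mono[of "S \<inter> S'" S spacetime] by (auto simp: noise_sets_def intro: le_less_trans)
  then have "has_bochner_integral spacetime (indicator (S \<inter> S')) (measure spacetime (S \<inter> S'))"
    using n by (intro has_bochner_integral_real_indicator) (auto simp: noise_sets_def)
  from has_bochner_integral_product[OF sigma_finite_spacetime sigma_finite_measure_axioms this Y]
  have "has_bochner_integral (spacetime \<Otimes>\<^sub>M M) (\<lambda>(z, \<omega>). indicator (S \<inter> S') z * (Y \<omega> * Y' \<omega>))
           (measure spacetime (S \<inter> S') * expectation (\<lambda>\<omega>. Y \<omega> * Y' \<omega>))" .
  also have "(\<lambda>(z, \<omega>). indicator (S \<inter> S') z * (Y \<omega> * Y' \<omega>))
      = (\<lambda>(z, \<omega>). (Y \<omega> * indicator S z) * (Y' \<omega> * indicator S' z))"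
    by (auto simp: indicator_def)
  finally show ?thesis .
qed

lemma elementary_mean:
  assumes e: "elementary a b A Y"
  shows "has_bochner_integral M (\<lambda>\<omega>. Y \<omega> * W ({a<..b} \<times> A) \<omega>) 0"
proof (rule past_times_future[where a=a])
  have [measurable]: "Y \<in> borel_measurable M" using e adapted_measurable by auto
  obtain C where C: "\<forall>\<omega>\<in>space M. \<bar>Y \<omega>\<bar> \<le> C" using e by auto
  have "integrable M (\<lambda>\<omega>. Y \<omega> * 1)"
    by (rule bounded_mult_integrable[OF _ C]) auto
  then show "integrable M Y" by simp
  show "W ({a<..b} \<times> A) \<in> noise_comb (future a)"
    using e slab_noise_sets by (intro noise_comb_base) (auto simp: future_def)
qed (use e in auto)

lemma simple_mean:
  assumes "valid_simple M W E" shows "has_bochner_integral M (simple_integral W E) 0"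
  using assms
proof (induction E)
  case (Cons p E)
  obtain a b A Y where p: "p = (a, b, A, Y)" by (cases p)
  have "elementary a b A Y" and E: "valid_simple M W E" using Cons.prems by (auto simp: valid_simple_def p)
  from has_bochner_integral_add[OF elementary_mean[OF this(1)] Cons.IH[OF E]]
  show ?case by (simp add: simple_integral_def[abs_def] p)
qed (simp add: simple_integral_def[abs_def] has_bochner_integral_zero)

text \<open>
  Both sides are bilinear in the list entries, and for single entries they agree by
  \<open>elementary_isometry\<close> and \<open>elementary_field\<close>; the common value is left unnamed because only
  the agreement matters for the passage to the limit.
\<close>

lemma simple_isometry:
  assumes E: "valid_simple M W E" and E': "valid_simple M W E'"
  shows "\<exists>r. has_bochner_integral M (\<lambda>\<omega>. simple_integral W E \<omega> * simple_integral W E' \<omega>) r \<and>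
    has_bochner_integral (spacetime \<Otimes>\<^sub>M M) (\<lambda>(z, \<omega>). simple_field E z \<omega> * simple_field E' z \<omega>) r"
  using E
proof (induction E)
  case Nil
  show ?case by (intro exI[of _ 0]) (simp add: simple_integral_def simple_field_def case_prod_unfold has_bochner_integral_zero)
next
  case (Cons p E)
  obtain a b A Y where p: "p = (a, b, A, Y)" by (cases p)
  have e: "elementary a b A Y" and E: "valid_simple M W E"
    using Cons.prems by (auto simp: valid_simple_def p)
  let ?S = "{a<..b} \<times> A"
  have "\<exists>r. has_bochner_integral M (\<lambda>\<omega>. (Y \<omega> * W ?S \<omega>) * simple_integral W E' \<omega>) r \<and>
    has_bochner_integral (spacetime \<Otimes>\<^sub>M M) (\<lambda>(z, \<omega>). (Y \<omega> * indicator ?S z) * simple_field E' z \<omega>) r"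
    using E'
  proof (induction E')
    case Nil
    show ?case by (intro exI[of _ 0]) (simp add: simple_integral_def simple_field_def case_prod_unfold has_bochner_integral_zero)
  next
    case (Cons p' E')
    obtain a' b' A' Y' where p': "p' = (a', b', A', Y')" by (cases p')
    have e': "elementary a' b' A' Y'" and E': "valid_simple M W E'"
      using Cons.prems by (auto simp: valid_simple_def p')
    obtain r where r: "has_bochner_integral M (\<lambda>\<omega>. (Y \<omega> * W ?S \<omega>) * simple_integral W E' \<omega>) r"
      "has_bochner_integral (spacetime \<Otimes>\<^sub>M M) (\<lambda>(z, \<omega>). (Y \<omega> * indicator ?S z) * simple_field E' z \<omega>) r"
      using Cons.IH[OF E'] by blast
    from has_bochner_integral_add[OF elementary_isometry[OF e e'] r(1)]
      has_bochner_integral_add[OF elementary_field[OF e e'] r(2)]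
    show ?case
      by (intro exI conjI) (simp_all add: simple_integral_def simple_field_def p' case_prod_unfold distrib_left)
  qed
  then obtain r where r: "has_bochner_integral M (\<lambda>\<omega>. (Y \<omega> * W ?S \<omega>) * simple_integral W E' \<omega>) r"
    "has_bochner_integral (spacetime \<Otimes>\<^sub>M M) (\<lambda>(z, \<omega>). (Y \<omega> * indicator ?S z) * simple_field E' z \<omega>) r"
    by blast
  obtain q where q: "has_bochner_integral M (\<lambda>\<omega>. simple_integral W E \<omega> * simple_integral W E' \<omega>) q"
    "has_bochner_integral (spacetime \<Otimes>\<^sub>M M) (\<lambda>(z, \<omega>). simple_field E z \<omega> * simple_field E' z \<omega>) q"
    using Cons.IH[OF E] by blast
  from has_bochner_integral_add[OF r(1) q(1)] has_bochner_integral_add[OF r(2) q(2)]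
  show ?case
    by (intro exI conjI) (simp_all add: simple_integral_def simple_field_def p case_prod_unfold distrib_right)
qed

lemma simple_field_measurable:
  assumes "valid_simple M W E"
  shows "(\<lambda>(z, \<omega>). simple_field E z \<omega>) \<in> borel_measurable (spacetime \<Otimes>\<^sub>M M)"
  using assms
proof (induction E)
  case (Cons p E)
  obtain a b A Y where p: "p = (a, b, A, Y)" by (cases p)
  have e: "elementary a b A Y" and E: "valid_simple M W E"
    using Cons.prems by (auto simp: valid_simple_def p)
  have [measurable]: "Y \<in> borel_measurable M" "{a<..b} \<times> A \<in> sets spacetime"
    using e adapted_measurable slab_noise_sets by (auto simp: noise_sets_def)
  note [measurable] = Cons.IH[OF E]
  have "(\<lambda>(z, \<omega>). Y \<omega> * indicator ({a<..b} \<times> A) z + simple_field E z \<omega>) \<in> borel_measurable (spacetime \<Otimes>\<^sub>M M)"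
    by measurable
  then show ?case by (simp add: simple_field_def p)
qed (simp add: simple_field_def[abs_def] case_prod_unfold)

text \<open>
  The mean is the inner product with the constant \<open>1\<close>, so it is covered by the same limit argument.
\<close>

lemma walsh_isometry:
  assumes X: "has_walsh_integral M W X Z" and X': "has_walsh_integral M W X' Z'"
  shows "has_bochner_integral M (\<lambda>\<omega>. Z \<omega> * Z' \<omega>) (\<integral>(z, \<omega>). X z \<omega> * X' z \<omega> \<partial>(spacetime \<Otimes>\<^sub>M M))"
    and "integrable (spacetime \<Otimes>\<^sub>M M) (\<lambda>(z, \<omega>). X z \<omega> * X' z \<omega>)"
    and "has_bochner_integral M Z 0"
proof -
  let ?P = "spacetime \<Otimes>\<^sub>M M"
  let ?u = "\<lambda>X (z, \<omega>). X z \<omega> :: real"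
  obtain E where E: "\<And>n. valid_simple M W (E n)"
    and EX: "(\<lambda>n. \<integral>\<^sup>+ (z, \<omega>). ennreal ((simple_field (E n) z \<omega> - X z \<omega>)\<^sup>2) \<partial>?P) \<longlonglongrightarrow> 0"
    and EZ: "(\<lambda>n. \<integral>\<^sup>+ \<omega>. ennreal ((simple_integral W (E n) \<omega> - Z \<omega>)\<^sup>2) \<partial>M) \<longlonglongrightarrow> 0"
    using X unfolding has_walsh_integral_def L2_norm_sq_def by blast
  obtain E' where E': "\<And>n. valid_simple M W (E' n)"
    and EX': "(\<lambda>n. \<integral>\<^sup>+ (z, \<omega>). ennreal ((simple_field (E' n) z \<omega> - X' z \<omega>)\<^sup>2) \<partial>?P) \<longlonglongrightarrow> 0"
    and EZ': "(\<lambda>n. \<integral>\<^sup>+ \<omega>. ennreal ((simple_integral W (E' n) \<omega> - Z' \<omega>)\<^sup>2) \<partial>M) \<longlonglongrightarrow> 0"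
    using X' unfolding has_walsh_integral_def L2_norm_sq_def by blast
  have m[measurable]: "?u X \<in> borel_measurable ?P" "?u X' \<in> borel_measurable ?P"
      "Z \<in> borel_measurable M" "Z' \<in> borel_measurable M"
    and fin: "(\<integral>\<^sup>+ (z, \<omega>). ennreal ((X z \<omega>)\<^sup>2) \<partial>?P) < \<infinity>" "(\<integral>\<^sup>+ (z, \<omega>). ennreal ((X' z \<omega>)\<^sup>2) \<partial>?P) < \<infinity>"
      "(\<integral>\<^sup>+ \<omega>. ennreal ((Z \<omega>)\<^sup>2) \<partial>M) < \<infinity>" "(\<integral>\<^sup>+ \<omega>. ennreal ((Z' \<omega>)\<^sup>2) \<partial>M) < \<infinity>"
    using X X' unfolding has_walsh_integral_def L2_norm_sq_def by auto
  have sm[measurable]: "simple_integral W (E n) \<in> borel_measurable M" "simple_integral W (E' n) \<in> borel_measurable M" for n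
    using simple_mean[OF E] simple_mean[OF E'] by (auto simp: has_bochner_integral_iff)
  have r: "\<exists>r. \<forall>n. has_bochner_integral M (\<lambda>\<omega>. simple_integral W (E n) \<omega> * simple_integral W (E' n) \<omega>) (r n) \<and>
    has_bochner_integral ?P (\<lambda>(z, \<omega>). simple_field (E n) z \<omega> * simple_field (E' n) z \<omega>) (r n)"
    using simple_isometry[OF E E'] by (intro choice) blast
  then obtain r where r: "\<And>n. has_bochner_integral M (\<lambda>\<omega>. simple_integral W (E n) \<omega> * simple_integral W (E' n) \<omega>) (r n)"
    "\<And>n. has_bochner_integral ?P (\<lambda>(z, \<omega>). simple_field (E n) z \<omega> * simple_field (E' n) z \<omega>) (r n)"
    by blast
  have "r \<longlonglongrightarrow> expectation (\<lambda>\<omega>. Z \<omega> * Z' \<omega>)"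
    by (rule L2_inner_tendsto[OF _ _ _ _ fin(3,4) EZ EZ' r(1)]) auto
  moreover have "r \<longlonglongrightarrow> (\<integral>p. ?u X p * ?u X' p \<partial>?P)"
    by (rule L2_inner_tendsto[where f="\<lambda>n. ?u (simple_field (E n))" and g="\<lambda>n. ?u (simple_field (E' n))"])
       (use fin(1,2) EX EX' r(2) simple_field_measurable[OF E] simple_field_measurable[OF E'] m
         in \<open>simp_all add: case_prod_unfold\<close>)
  ultimately have "expectation (\<lambda>\<omega>. Z \<omega> * Z' \<omega>) = (\<integral>p. ?u X p * ?u X' p \<partial>?P)"
    by (rule LIMSEQ_unique)
  moreover have "integrable M (\<lambda>\<omega>. Z \<omega> * Z' \<omega>)" by (rule L2_integrable_mult) (use fin in auto)
  ultimately show "has_bochner_integral M (\<lambda>\<omega>. Z \<omega> * Z' \<omega>) (\<integral>(z, \<omega>). X z \<omega> * X' z \<omega> \<partial>?P)"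
    by (simp add: has_bochner_integral_iff case_prod_unfold)
  have "integrable ?P (\<lambda>p. ?u X p * ?u X' p)"
    by (rule L2_integrable_mult) (use fin m in \<open>simp_all add: case_prod_unfold\<close>)
  then show "integrable ?P (\<lambda>(z, \<omega>). X z \<omega> * X' z \<omega>)" by (simp add: case_prod_unfold)
  have "(\<lambda>_. 0) \<longlonglongrightarrow> expectation (\<lambda>\<omega>. Z \<omega> * 1)"
  proof (rule L2_inner_tendsto[where g="\<lambda>_ _. 1", OF _ _ _ _ fin(3) _ EZ])
    show "has_bochner_integral M (\<lambda>\<omega>. simple_integral W (E n) \<omega> * 1) 0" for n
      using simple_mean[OF E] by simp
  qed (auto simp: emeasure_space_1)
  then have "expectation Z = 0" by (simp add: LIMSEQ_const_iff)
  moreover have "integrable M (\<lambda>\<omega>. Z \<omega> * 1)"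
    by (rule L2_integrable_mult) (use fin in \<open>auto simp: emeasure_space_1\<close>)
  ultimately show "has_bochner_integral M Z 0" by (simp add: has_bochner_integral_iff)
qed

end

section \<open>The integral equation of the second moment\<close>

definition back_cone :: "real \<Rightarrow> real \<Rightarrow> real \<Rightarrow> (real \<times> real) set" where
  "back_cone \<kappa> t x = {(s, y). 0 \<le> s \<and> \<bar>y - x\<bar> \<le> \<kappa> * (t - s)}"

definition cone_integral :: "real \<Rightarrow> (real \<times> real \<Rightarrow> ennreal) \<Rightarrow> real \<times> real \<Rightarrow> ennreal" where
  "cone_integral \<kappa> f z = (\<integral>\<^sup>+w. f w * indicator (back_cone \<kappa> (fst z) (snd z)) w \<partial>lborel)"

text \<open>
  The terms of the series of \<open>cosh (\<bar>l\<bar> sqrt (\<kappa>/2) t)\<close> and of \<open>\<K>/l\<^sup>2\<close>.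
\<close>

definition cosh_term :: "real \<Rightarrow> real \<Rightarrow> nat \<Rightarrow> real \<Rightarrow> real" where
  "cosh_term \<kappa> l n t = (l\<^sup>2 * \<kappa> / 2 * t\<^sup>2) ^ n / fact (2 * n)"

definition bessel_term :: "real \<Rightarrow> real \<Rightarrow> nat \<Rightarrow> real \<times> real \<Rightarrow> real" where
  "bessel_term \<kappa> l n z = (case z of (t, x) \<Rightarrow>
     if \<bar>x\<bar> \<le> \<kappa> * t then 1/4 * (l\<^sup>2 / (8 * \<kappa>) * ((\<kappa> * t + x) * (\<kappa> * t - x))) ^ n / (fact n)\<^sup>2 else 0)"

lemma cone_borel[measurable]: "back_cone \<kappa> t x \<in> sets borel"
proof -
  have "back_cone \<kappa> t x = {z. 0 \<le> fst z} \<inter> {z. \<bar>snd z - x\<bar> \<le> \<kappa> * (t - fst z)}"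
    by (auto simp: back_cone_def)
  moreover have "closed {z :: real \<times> real. 0 \<le> fst z}" "closed {z :: real \<times> real. \<bar>snd z - x\<bar> \<le> \<kappa> * (t - fst z)}"
    by (intro closed_Collect_le continuous_intros)+
  ultimately show ?thesis by (auto intro!: borel_closed)
qed

lemma cosh_term_borel[measurable]: "(\<lambda>z :: real \<times> real. ennreal (cosh_term \<kappa> l n (fst z))) \<in> borel_measurable borel"
  unfolding cosh_term_def by (simp add: borel_prod[symmetric])

lemma bessel_term_borel[measurable]: "(\<lambda>z. ennreal (bessel_term \<kappa> l n z)) \<in> borel_measurable borel"
  unfolding bessel_term_def case_prod_unfold borel_prod[symmetric] by measurable

lemma cone_subset:
  assumes "\<kappa> > 0" "(s, y) \<in> back_cone \<kappa> t x" shows "back_cone \<kappa> s y \<subseteq> back_cone \<kappa> t x"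
proof safe
  fix r z assume "(r, z) \<in> back_cone \<kappa> s y"
  then have "0 \<le> r" "\<bar>z - y\<bar> \<le> \<kappa> * (s - r)" "\<bar>y - x\<bar> \<le> \<kappa> * (t - s)"
    using assms by (auto simp: back_cone_def)
  moreover have "\<kappa> * (s - r) + \<kappa> * (t - s) = \<kappa> * (t - r)" by (simp add: algebra_simps)
  ultimately show "(r, z) \<in> back_cone \<kappa> t x" unfolding back_cone_def by auto
qed

lemma apex_in_cone: "0 \<le> t \<Longrightarrow> (t, x) \<in> back_cone \<kappa> t x"
  by (simp add: back_cone_def)

lemma cone_time_le: "\<kappa> > 0 \<Longrightarrow> (s, y) \<in> back_cone \<kappa> t x \<Longrightarrow> s \<le> t"
  by (auto simp: back_cone_def) (smt (verit) mult_pos_neg)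

lemma nn_integral_lborel_prod:
  assumes [measurable]: "f \<in> borel_measurable borel"
  shows "(\<integral>\<^sup>+z. f z \<partial>lborel) = (\<integral>\<^sup>+s. (\<integral>\<^sup>+y. f (s, y) \<partial>(lborel :: real measure)) \<partial>(lborel :: real measure))"
  using lborel.nn_integral_fst[of f "lborel :: real measure"] by (simp add: lborel_prod)

text \<open>
  The change of variables \<open>p = \<kappa>s + y\<close>, \<open>q = \<kappa>s - y\<close>, obtained from one-dimensional affine
  substitutions: first \<open>p\<close> replaces \<open>y\<close> for fixed \<open>s\<close>, and after exchanging the integrals
  \<open>q = 2\<kappa>s - p\<close> replaces \<open>s\<close> for fixed \<open>p\<close>.
\<close>

lemma nn_integral_light_cone:
  fixes f g :: "real \<Rightarrow> ennreal"
  assumes [measurable]: "f \<in> borel_measurable borel" "g \<in> borel_measurable borel" and \<kappa>: "\<kappa> > 0"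
  shows "(\<integral>\<^sup>+z. f (\<kappa> * fst z + snd z) * g (\<kappa> * fst z - snd z) \<partial>lborel)
    = ennreal (1 / (2 * \<kappa>)) * ((\<integral>\<^sup>+p. f p \<partial>lborel) * (\<integral>\<^sup>+q. g q \<partial>lborel))"
proof -
  have "(\<integral>\<^sup>+z. f (\<kappa> * fst z + snd z) * g (\<kappa> * fst z - snd z) \<partial>lborel)
      = (\<integral>\<^sup>+s. (\<integral>\<^sup>+y. f (\<kappa> * s + y) * g (\<kappa> * s - y) \<partial>lborel) \<partial>lborel)"
    by (subst nn_integral_lborel_prod) (simp_all add: borel_prod[symmetric])
  also have "\<dots> = (\<integral>\<^sup>+s. (\<integral>\<^sup>+p. f p * g (2 * \<kappa> * s - p) \<partial>lborel) \<partial>lborel)"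
  proof (rule nn_integral_cong)
    fix s
    show "(\<integral>\<^sup>+y. f (\<kappa> * s + y) * g (\<kappa> * s - y) \<partial>lborel) = (\<integral>\<^sup>+p. f p * g (2 * \<kappa> * s - p) \<partial>lborel)"
      by (subst (2) nn_integral_real_affine[where c=1 and t="\<kappa> * s"]) (auto simp: algebra_simps)
  qed
  also have "\<dots> = (\<integral>\<^sup>+p. (\<integral>\<^sup>+s. f p * g (2 * \<kappa> * s - p) \<partial>lborel) \<partial>lborel)"
    by (rule lborel_pair.Fubini'[symmetric]) simp
  also have "\<dots> = (\<integral>\<^sup>+p. f p * (ennreal (1 / (2 * \<kappa>)) * (\<integral>\<^sup>+q. g q \<partial>lborel)) \<partial>lborel)"
  proof (rule nn_integral_cong)
    fix p
    have "(\<integral>\<^sup>+q. g q \<partial>lborel) = ennreal (2 * \<kappa>) * (\<integral>\<^sup>+s. g (2 * \<kappa> * s - p) \<partial>lborel)"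
      using \<kappa> by (subst nn_integral_real_affine[where c="2 * \<kappa>" and t="- p"]) auto
    then have "ennreal (1 / (2 * \<kappa>)) * (\<integral>\<^sup>+q. g q \<partial>lborel) = (\<integral>\<^sup>+s. g (2 * \<kappa> * s - p) \<partial>lborel)"
      using \<kappa> by (simp add: mult.assoc[symmetric] ennreal_mult[symmetric])
    then show "(\<integral>\<^sup>+s. f p * g (2 * \<kappa> * s - p) \<partial>lborel) = f p * (ennreal (1 / (2 * \<kappa>)) * (\<integral>\<^sup>+q. g q \<partial>lborel))"
      by (simp add: nn_integral_cmult)
  qed
  also have "\<dots> = ennreal (1 / (2 * \<kappa>)) * ((\<integral>\<^sup>+p. f p \<partial>lborel) * (\<integral>\<^sup>+q. g q \<partial>lborel))"
    by (simp add: nn_integral_multc mult_ac)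
  finally show ?thesis .
qed

lemma nn_integral_power_Icc:
  assumes "0 \<le> P"
  shows "(\<integral>\<^sup>+p. ennreal (p ^ n) * indicator {0..P} p \<partial>lborel) = ennreal (P ^ Suc n / real (Suc n))"
proof -
  have "(\<integral>\<^sup>+p. ennreal (p ^ n) * indicator {0..P} p \<partial>lborel)
      = ennreal (P ^ Suc n / real (Suc n) - 0 ^ Suc n / real (Suc n))"
  proof (intro nn_integral_FTC_Icc)
    fix p assume p: "p \<in> {0..P}"
    show "((\<lambda>p. p ^ Suc n / real (Suc n)) has_real_derivative p ^ n) (at p)"
      using DERIV_cdivide[OF DERIV_pow[of "Suc n" p], of "real (Suc n)"]
      by (simp del: of_nat_Suc power_Suc)
    show "0 \<le> p ^ n" using p by simp
  qed (use assms in auto)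
  then show ?thesis by simp
qed

text \<open>
  In the light-cone coordinates of the integration variable, the intersection of the support of the
  term with the backward cone is the rectangle \<open>[0,P] \<times> [0,Q]\<close>, and the term is a multiple of
  \<open>p\<^sup>n q\<^sup>n\<close>.
\<close>

lemma cone_integral_bessel_term:
  assumes \<kappa>: "\<kappa> > 0"
  shows "ennreal (l\<^sup>2 / 4) * cone_integral \<kappa> (\<lambda>z. ennreal (bessel_term \<kappa> l n z)) (t, x)
    = ennreal (bessel_term \<kappa> l (Suc n) (t, x))"
proof -
  define P where "P = \<kappa> * t + x"
  define Q where "Q = \<kappa> * t - x"
  define r where "r = l\<^sup>2 / (8 * \<kappa>)"
  define c where "c = 1/4 * r ^ n / (fact n)\<^sup>2"
  have c: "0 \<le> c" using \<kappa> by (simp add: c_def r_def)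
  have pow: "(r * (p * q)) ^ k = r ^ k * (p ^ k * q ^ k)" for p q k
    by (simp only: power_mult_distrib)
  have bt: "bessel_term \<kappa> l k (s, y) = (if \<bar>y\<bar> \<le> \<kappa> * s
      then 1/4 * (r * ((\<kappa> * s + y) * (\<kappa> * s - y))) ^ k / (fact k)\<^sup>2 else 0)" for k s y
    by (simp add: bessel_term_def r_def)
  let ?f = "\<lambda>R p. ennreal (p ^ n) * indicator {0..R} p"
  \<comment> \<open>In light-cone coordinates the restricted term is a product of functions of one variable.\<close>
  have pt: "ennreal (bessel_term \<kappa> l n w) * indicator (back_cone \<kappa> t x) w
      = ennreal c * (?f P (\<kappa> * fst w + snd w) * ?f Q (\<kappa> * fst w - snd w))" for w
  proof -
    obtain s y where w: "w = (s, y)" by (cases w)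
    let ?p = "\<kappa> * s + y" and ?q = "\<kappa> * s - y"
    have iff: "\<bar>y\<bar> \<le> \<kappa> * s \<and> (s, y) \<in> back_cone \<kappa> t x \<longleftrightarrow> ?p \<in> {0..P} \<and> ?q \<in> {0..Q}"
    proof -
      have "0 \<le> s" if "\<bar>y\<bar> \<le> \<kappa> * s" using that \<kappa> by (smt (verit) mult_pos_neg)
      then show ?thesis by (auto simp: back_cone_def P_def Q_def algebra_simps abs_le_iff)
    qed
    show ?thesis
    proof (cases "?p \<in> {0..P} \<and> ?q \<in> {0..Q}")
      case True
      then have "bessel_term \<kappa> l n w = c * (?p ^ n * ?q ^ n)"
        using iff by (simp add: bt w c_def pow)
      moreover have "w \<in> back_cone \<kappa> t x" using True iff w by simp
      ultimately show ?thesis using True c by (simp add: w ennreal_mult)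
    next
      case False
      then have "\<not> (\<bar>y\<bar> \<le> \<kappa> * s \<and> w \<in> back_cone \<kappa> t x)" using iff w by simp
      with False show ?thesis by (auto simp: w bt)
    qed
  qed
  have [measurable]: "(\<lambda>w. ?f P (\<kappa> * fst w + snd w) * ?f Q (\<kappa> * fst w - snd w)) \<in> borel_measurable borel"
    unfolding borel_prod[symmetric] by measurable
  have "cone_integral \<kappa> (\<lambda>z. ennreal (bessel_term \<kappa> l n z)) (t, x)
      = ennreal c * (\<integral>\<^sup>+w. ?f P (\<kappa> * fst w + snd w) * ?f Q (\<kappa> * fst w - snd w) \<partial>lborel)"
    unfolding cone_integral_def fst_conv snd_conv pt by (rule nn_integral_cmult) simp
  also have "\<dots> = ennreal c * (ennreal (1 / (2 * \<kappa>)) * ((\<integral>\<^sup>+p. ?f P p \<partial>lborel) * (\<integral>\<^sup>+q. ?f Q q \<partial>lborel)))"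
    using \<kappa> by (subst nn_integral_light_cone) auto
  finally have *: "cone_integral \<kappa> (\<lambda>z. ennreal (bessel_term \<kappa> l n z)) (t, x)
      = ennreal c * (ennreal (1 / (2 * \<kappa>)) * ((\<integral>\<^sup>+p. ?f P p \<partial>lborel) * (\<integral>\<^sup>+q. ?f Q q \<partial>lborel)))" .
  show ?thesis
  proof (cases "\<bar>x\<bar> \<le> \<kappa> * t")
    case True
    then have PQ: "0 \<le> P" "0 \<le> Q" by (auto simp: P_def Q_def)
    have "l\<^sup>2 / 4 = 2 * \<kappa> * r" using \<kappa> by (simp add: r_def)
    then have "l\<^sup>2 / 4 * (c * (1 / (2 * \<kappa>) * (P ^ Suc n / real (Suc n) * (Q ^ Suc n / real (Suc n)))))
        = 1/4 * (r * (P * Q)) ^ Suc n / (fact (Suc n))\<^sup>2"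
      using \<kappa> unfolding pow by (simp add: c_def power2_eq_square mult_ac del: of_nat_Suc)
    moreover have "bessel_term \<kappa> l (Suc n) (t, x) = 1/4 * (r * (P * Q)) ^ Suc n / (fact (Suc n))\<^sup>2"
      using True by (simp only: bt if_True P_def Q_def)
    ultimately show ?thesis
      using PQ c \<kappa>
      by (simp add: * nn_integral_power_Icc ennreal_mult[symmetric] del: of_nat_Suc power_Suc fact_Suc)
  next
    case False
    then have "P < 0 \<or> Q < 0" by (auto simp: P_def Q_def)
    then have "(\<integral>\<^sup>+p. ?f P p \<partial>lborel) = 0 \<or> (\<integral>\<^sup>+q. ?f Q q \<partial>lborel) = 0" by auto
    then show ?thesis using False by (auto simp: * bt)
  qed
qed

text \<open>
  At time \<open>s\<close> the cone has width \<open>2\<kappa>(t - s)\<close>, so this is the integral of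
  \<open>(t - s) s\<^bsup>2n\<^esup>\<close> over \<open>[0,t]\<close>.
\<close>

lemma cone_integral_cosh_term:
  assumes \<kappa>: "\<kappa> > 0" and t: "t \<ge> 0"
  shows "ennreal (l\<^sup>2 / 4) * cone_integral \<kappa> (\<lambda>z. ennreal (cosh_term \<kappa> l n (fst z))) (t, x)
    = ennreal (cosh_term \<kappa> l (Suc n) t)"
proof -
  define A where "A = l\<^sup>2 * \<kappa> / 2"
  define c where "c = A ^ n / fact (2 * n)"
  have c: "0 \<le> c" using \<kappa> by (simp add: c_def A_def)
  have ct: "cosh_term \<kappa> l k s = A ^ k * s ^ (2 * k) / fact (2 * k)" for k s
    unfolding cosh_term_def A_def[symmetric] by (subst power_mult_distrib) (simp add: power_mult)
  have ctn: "cosh_term \<kappa> l n s = c * s ^ (2 * n)" for s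
    by (simp add: ct c_def)
  have [measurable]: "(\<lambda>s. ennreal (cosh_term \<kappa> l n s)) \<in> borel_measurable borel"
    unfolding cosh_term_def by measurable
  have [measurable]: "(\<lambda>z. ennreal (cosh_term \<kappa> l n (fst z)) * indicator (back_cone \<kappa> t x) z) \<in> borel_measurable (borel :: (real \<times> real) measure)"
    by measurable
  have "cone_integral \<kappa> (\<lambda>z. ennreal (cosh_term \<kappa> l n (fst z))) (t, x)
      = (\<integral>\<^sup>+s. (\<integral>\<^sup>+y. ennreal (cosh_term \<kappa> l n s) * indicator (back_cone \<kappa> t x) (s, y) \<partial>lborel) \<partial>lborel)"
    unfolding cone_integral_def by (subst nn_integral_lborel_prod) simp_all
  also have "\<dots> = (\<integral>\<^sup>+s. ennreal (c * (2 * \<kappa>) * (t * s ^ (2 * n) - s ^ (2 * n + 1))) * indicator {0..t} s \<partial>lborel)"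
  proof (rule nn_integral_cong)
    fix s
    have "(\<integral>\<^sup>+y. ennreal (cosh_term \<kappa> l n s) * indicator (back_cone \<kappa> t x) (s, y) \<partial>lborel)
        = (\<integral>\<^sup>+y. ennreal (cosh_term \<kappa> l n s) * indicator {0..} s * indicator {x - \<kappa> * (t - s)..x + \<kappa> * (t - s)} y \<partial>lborel)"
      by (intro nn_integral_cong) (auto simp: back_cone_def indicator_def abs_le_iff)
    also have "\<dots> = ennreal (cosh_term \<kappa> l n s) * indicator {0..} s * emeasure lborel {x - \<kappa> * (t - s)..x + \<kappa> * (t - s)}"
      by (subst nn_integral_cmult) auto
    also have "\<dots> = ennreal (c * (2 * \<kappa>) * (t * s ^ (2 * n) - s ^ (2 * n + 1))) * indicator {0..t} s"
    proof (cases "s \<in> {0..t}")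
      case True
      have eq: "cosh_term \<kappa> l n s * (2 * (\<kappa> * (t - s))) = c * (2 * \<kappa>) * (t * s ^ (2 * n) - s ^ (2 * n + 1))"
        by (simp add: ctn algebra_simps)
      have nn: "0 \<le> cosh_term \<kappa> l n s" "0 \<le> 2 * (\<kappa> * (t - s))"
        using \<kappa> True by (auto simp: cosh_term_def)
      have "ennreal (cosh_term \<kappa> l n s) * ennreal (2 * (\<kappa> * (t - s)))
          = ennreal (c * (2 * \<kappa>) * (t * s ^ (2 * n) - s ^ (2 * n + 1)))"
        unfolding eq[symmetric] by (rule ennreal_mult[OF nn, symmetric])
      then show ?thesis
        using True nn by simp
    next
      case False
      then have "s < 0 \<or> \<kappa> * (t - s) < 0" using \<kappa> by (auto simp: mult_pos_neg)
      then show ?thesis using False by (auto simp: indicator_def)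
    qed
    finally show "(\<integral>\<^sup>+y. ennreal (cosh_term \<kappa> l n s) * indicator (back_cone \<kappa> t x) (s, y) \<partial>lborel)
        = ennreal (c * (2 * \<kappa>) * (t * s ^ (2 * n) - s ^ (2 * n + 1))) * indicator {0..t} s" .
  qed
  also have "\<dots> = ennreal (c * (2 * \<kappa>) * (t * t ^ (2 * n + 1) / real (2 * n + 1) - t ^ (2 * n + 2) / real (2 * n + 2))
      - c * (2 * \<kappa>) * (t * 0 ^ (2 * n + 1) / real (2 * n + 1) - 0 ^ (2 * n + 2) / real (2 * n + 2)))"
  proof (rule nn_integral_FTC_Icc)
    fix s assume s: "s \<in> {0..t}"
    show "((\<lambda>s. c * (2 * \<kappa>) * (t * s ^ (2 * n + 1) / real (2 * n + 1) - s ^ (2 * n + 2) / real (2 * n + 2)))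
        has_real_derivative c * (2 * \<kappa>) * (t * s ^ (2 * n) - s ^ (2 * n + 1))) (at s)"
      by (rule derivative_eq_intros refl | simp del: of_nat_add of_nat_mult of_nat_Suc)+
    have "s ^ (2 * n) * s \<le> s ^ (2 * n) * t" using s by (intro mult_left_mono) auto
    then show "0 \<le> c * (2 * \<kappa>) * (t * s ^ (2 * n) - s ^ (2 * n + 1))"
      using c \<kappa> by (intro mult_nonneg_nonneg) (auto simp: mult_ac)
  qed (use t in auto)
  also have "c * (2 * \<kappa>) * (t * t ^ (2 * n + 1) / real (2 * n + 1) - t ^ (2 * n + 2) / real (2 * n + 2))
      - c * (2 * \<kappa>) * (t * 0 ^ (2 * n + 1) / real (2 * n + 1) - 0 ^ (2 * n + 2) / real (2 * n + 2))
    = c * (2 * \<kappa>) * (t ^ (2 * n + 2) * (1 / real (2 * n + 1) - 1 / real (2 * n + 2)))"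
    by (simp add: algebra_simps)
  also have "1 / real (2 * n + 1) - 1 / real (2 * n + 2) = 1 / (real (2 * n + 1) * real (2 * n + 2))"
    by (simp add: divide_simps)
  finally have *: "cone_integral \<kappa> (\<lambda>z. ennreal (cosh_term \<kappa> l n (fst z))) (t, x)
      = ennreal (c * (2 * \<kappa>) * (t ^ (2 * n + 2) * (1 / (real (2 * n + 1) * real (2 * n + 2)))))" .
  define d where "d = real (2 * n + 1) * real (2 * n + 2)"
  have f: "fact (2 * Suc n) = d * fact (2 * n)"
    by (simp add: d_def algebra_simps)
  \<comment> \<open>\<open>A = l\<^sup>2/4 * 2\<kappa>\<close> is the ratio of the coefficients, and \<open>d\<close> the ratio of the factorials.\<close>
  have "l\<^sup>2 / 4 * (c * (2 * \<kappa>) * (t ^ (2 * n + 2) * (1 / d))) = A * c * (t ^ (2 * n + 2) * (1 / d))"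
    by (simp add: A_def)
  also have "\<dots> = A ^ Suc n * t ^ (2 * Suc n) / (d * fact (2 * n))"
    by (simp add: c_def mult_ac)
  also have "\<dots> = cosh_term \<kappa> l (Suc n) t"
    by (simp only: ct f)
  finally have "l\<^sup>2 / 4 * (c * (2 * \<kappa>) * (t ^ (2 * n + 2) * (1 / (real (2 * n + 1) * real (2 * n + 2)))))
      = cosh_term \<kappa> l (Suc n) t"
    unfolding d_def .
  then show ?thesis
    using c \<kappa> t by (simp add: * ennreal_mult[symmetric])
qed

lemma cosh_term_nonneg: "\<kappa> > 0 \<Longrightarrow> 0 \<le> cosh_term \<kappa> l n t"
  by (simp add: cosh_term_def)

lemma bessel_term_nonneg: "\<kappa> > 0 \<Longrightarrow> 0 \<le> bessel_term \<kappa> l n z"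
  by (auto simp: bessel_term_def split: prod.split intro!: mult_nonneg_nonneg divide_nonneg_nonneg zero_le_power)

lemma cosh_term_sums:
  assumes "\<kappa> > 0" shows "(\<lambda>n. cosh_term \<kappa> l n t) sums cosh (\<bar>l\<bar> * sqrt (\<kappa> / 2) * t)"
proof -
  define x where "x = \<bar>l\<bar> * sqrt (\<kappa> / 2) * t"
  define f where "f n = (if even n then x ^ n /\<^sub>R fact n else 0)" for n
  have "(\<lambda>n. f (2 * n)) sums cosh x \<longleftrightarrow> f sums cosh x"
  proof (rule sums_mono_reindex)
    show "strict_mono ((*) (2 :: nat))" by (rule strict_monoI) simp
    show "f n = 0" if "n \<notin> range ((*) 2)" for n
      using that by (metis evenE rangeI f_def)
  qed
  moreover have "f sums cosh x"
    using cosh_converges[of x] unfolding f_def .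
  moreover have "x\<^sup>2 = l\<^sup>2 * \<kappa> / 2 * t\<^sup>2"
    using assms unfolding x_def by (simp add: power_mult_distrib)
  then have "cosh_term \<kappa> l n t = (x\<^sup>2) ^ n / fact (2 * n)" for n
    by (simp only: cosh_term_def)
  then have "f (2 * n) = cosh_term \<kappa> l n t" for n
    by (simp only: f_def dvd_triv_left if_True real_scaleR_def divide_inverse_commute power_mult)
  ultimately show ?thesis by (simp add: x_def)
qed

lemma bessel_term_sums:
  assumes \<kappa>: "\<kappa> > 0" and l: "l \<noteq> 0"
  shows "(\<lambda>n. bessel_term \<kappa> l n (t, x)) sums (1 / l\<^sup>2 * K_fun \<kappa> l t x)"
proof (cases "\<bar>x\<bar> \<le> \<kappa> * t")
  case False
  then show ?thesis by (auto simp: bessel_term_def K_fun_def abs_le_iff)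
next
  case True
  define w where "w = l\<^sup>2 / (8 * \<kappa>) * ((\<kappa> * t + x) * (\<kappa> * t - x))"
  have w: "0 \<le> w" using True \<kappa> by (auto simp: w_def intro!: mult_nonneg_nonneg)
  let ?z = "sqrt (l\<^sup>2 * ((\<kappa> * t)\<^sup>2 - x\<^sup>2) / (2 * \<kappa>))"
  have "(\<kappa> * t)\<^sup>2 - x\<^sup>2 = (\<kappa> * t + x) * (\<kappa> * t - x)"
    by (simp add: power2_eq_square algebra_simps)
  then have "l\<^sup>2 * ((\<kappa> * t)\<^sup>2 - x\<^sup>2) / (2 * \<kappa>) = 4 * w" by (simp add: w_def)
  then have z: "(?z / 2)\<^sup>2 = w" using w by (simp add: power_divide)
  have "summable (\<lambda>n. w ^ n / (fact n)\<^sup>2)"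
  proof (rule summable_comparison_test'[OF summable_exp[of w]])
    fix n :: nat
    have "1 * fact n \<le> (fact n)\<^sup>2 * (1 :: real)"
      unfolding power2_eq_square using fact_ge_1[of n, where 'a=real] by simp
    then show "norm (w ^ n / (fact n)\<^sup>2) \<le> inverse (fact n) * w ^ n"
      using w by (simp add: divide_inverse mult.commute[of _ "w ^ n"] mult_left_mono le_imp_inverse_le)
  qed
  moreover have "(?z / 2) ^ (2 * n + 0) / (fact n * fact (n + 0)) = w ^ n / (fact n)\<^sup>2" for n
    by (simp add: power_mult z power2_eq_square[of "fact n"] del: real_sqrt_eq_zero_cancel_iff)
  ultimately have "(\<lambda>n. w ^ n / (fact n)\<^sup>2) sums bessel_I 0 ?z"
    unfolding bessel_I_def by (simp only: summable_sums)
  from sums_mult[OF this, of "1/4"]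
  have "(\<lambda>n. 1/4 * (w ^ n / (fact n)\<^sup>2)) sums (1/4 * bessel_I 0 ?z)" .
  moreover have "bessel_term \<kappa> l n (t, x) = 1/4 * (w ^ n / (fact n)\<^sup>2)" for n
    using True by (simp only: bessel_term_def prod.case if_True w_def times_divide_eq_right)
  moreover have "1 / l\<^sup>2 * K_fun \<kappa> l t x = 1/4 * bessel_I 0 ?z"
    using True l by (simp add: K_fun_def abs_le_iff)
  ultimately show ?thesis by (simp only:)
qed

lemma cone_integral_mono:
  "(\<And>w. w \<in> back_cone \<kappa> (fst z) (snd z) \<Longrightarrow> f w \<le> g w) \<Longrightarrow> cone_integral \<kappa> f z \<le> cone_integral \<kappa> g z"
  unfolding cone_integral_def by (intro nn_integral_mono) (auto simp: indicator_def)

lemma cone_integral_add: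
  assumes [measurable]: "f \<in> borel_measurable borel" "g \<in> borel_measurable borel"
  shows "cone_integral \<kappa> (\<lambda>w. f w + g w) z = cone_integral \<kappa> f z + cone_integral \<kappa> g z"
  unfolding cone_integral_def by (simp add: distrib_right nn_integral_add)

lemma cone_integral_cmult:
  assumes [measurable]: "f \<in> borel_measurable borel"
  shows "cone_integral \<kappa> (\<lambda>w. c * f w) z = c * cone_integral \<kappa> f z"
  unfolding cone_integral_def by (simp add: mult.assoc nn_integral_cmult)

lemma cone_integral_zero: "cone_integral \<kappa> (\<lambda>w. 0) z = 0"
  by (simp add: cone_integral_def)

lemma cone_integral_sum:
  assumes [measurable]: "\<And>i. f i \<in> borel_measurable borel"
  shows "cone_integral \<kappa> (\<lambda>w. \<Sum>i<(n::nat). f i w) z = (\<Sum>i<n. cone_integral \<kappa> (f i) z)"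
  by (induction n) (simp_all add: cone_integral_add cone_integral_zero)

text \<open>
  Substituting the equation into itself shows by induction that \<open>V\<close> dominates every partial sum of
  the iterates.  In the other direction the same substitution, started from the bound \<open>C\<close> on the
  cone, shows that \<open>V\<close> exceeds the \<open>n\<close>-th partial sum by at most \<open>C\<close> times the \<open>n\<close>-th term
  of the \<open>cosh\<close> series: the cone integral maps the constant \<open>C\<close>, which is the zeroth such term,
  to the following ones.
\<close>

lemma picard_sum:
  fixes V :: "real \<times> real \<Rightarrow> ennreal" and m :: "nat \<Rightarrow> real \<times> real \<Rightarrow> ennreal"
  assumes \<kappa>: "\<kappa> > 0" and t: "t \<ge> 0"
    and [measurable]: "V \<in> borel_measurable borel" "\<And>n. m n \<in> borel_measurable borel"
    and step: "\<And>n s y. s \<ge> 0 \<Longrightarrow> ennreal (l\<^sup>2 / 4) * cone_integral \<kappa> (m n) (s, y) = m (Suc n) (s, y)"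
    and V: "\<And>s y. s \<ge> 0 \<Longrightarrow> V (s, y) = m 0 (s, y) + ennreal (l\<^sup>2 / 4) * cone_integral \<kappa> V (s, y)"
    and bdd: "\<And>z. z \<in> back_cone \<kappa> t x \<Longrightarrow> V z \<le> ennreal C" and C: "0 \<le> C"
  shows "V (t, x) = (\<Sum>n. m n (t, x))"
proof -
  let ?a = "ennreal (l\<^sup>2 / 4)"
  \<comment> \<open>Applying the equation to a partial sum lengthens it by one term.\<close>
  have shift: "m 0 (s, y) + ?a * cone_integral \<kappa> (\<lambda>w. \<Sum>i<n. m i w) (s, y) = (\<Sum>i<Suc n. m i (s, y))"
    if "s \<ge> 0" for s y n
    by (subst sum.lessThan_Suc_shift) (simp add: cone_integral_sum sum_distrib_left step that)
  have lower: "(\<Sum>i<n. m i (s, y)) \<le> V (s, y)" if "s \<ge> 0" for n s y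
    using that
  proof (induction n arbitrary: s y)
    case (Suc n)
    have "cone_integral \<kappa> (\<lambda>w. \<Sum>i<n. m i w) (s, y) \<le> cone_integral \<kappa> V (s, y)"
      by (rule cone_integral_mono) (auto simp: back_cone_def intro!: Suc.IH)
    then show ?case
      unfolding shift[OF Suc.prems, symmetric] V[OF Suc.prems]
      by (intro add_left_mono mult_left_mono) auto
  qed simp
  have upper: "V (s, y) \<le> (\<Sum>i<n. m i (s, y)) + ennreal C * ennreal (cosh_term \<kappa> l n s)"
    if "(s, y) \<in> back_cone \<kappa> t x" for n s y
    using that
  proof (induction n arbitrary: s y)
    case 0
    then show ?case using bdd by (simp add: cosh_term_def)
  next
    case (Suc n)
    have s: "s \<ge> 0" using Suc.prems by (simp add: back_cone_def)
    have "cone_integral \<kappa> V (s, y)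
        \<le> cone_integral \<kappa> (\<lambda>w. (\<Sum>i<n. m i w) + ennreal C * ennreal (cosh_term \<kappa> l n (fst w))) (s, y)"
      using cone_subset[OF \<kappa> Suc.prems] by (intro cone_integral_mono) (auto intro!: Suc.IH)
    also have "\<dots> = cone_integral \<kappa> (\<lambda>w. \<Sum>i<n. m i w) (s, y)
        + ennreal C * cone_integral \<kappa> (\<lambda>w. ennreal (cosh_term \<kappa> l n (fst w))) (s, y)"
      by (simp add: cone_integral_add cone_integral_cmult)
    finally have "V (s, y) \<le> m 0 (s, y) + ?a * (cone_integral \<kappa> (\<lambda>w. \<Sum>i<n. m i w) (s, y)
        + ennreal C * cone_integral \<kappa> (\<lambda>w. ennreal (cosh_term \<kappa> l n (fst w))) (s, y))"
      unfolding V[OF s] by (intro add_left_mono mult_left_mono) auto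
    also have "\<dots> = (m 0 (s, y) + ?a * cone_integral \<kappa> (\<lambda>w. \<Sum>i<n. m i w) (s, y))
        + ennreal C * (?a * cone_integral \<kappa> (\<lambda>w. ennreal (cosh_term \<kappa> l n (fst w))) (s, y))"
      by (simp add: algebra_simps)
    also have "\<dots> = (\<Sum>i<Suc n. m i (s, y)) + ennreal C * ennreal (cosh_term \<kappa> l (Suc n) s)"
      unfolding shift[OF s] cone_integral_cosh_term[OF \<kappa> s] ..
    finally show ?case .
  qed
  have sums: "(\<lambda>n. \<Sum>i<n. m i (t, x)) \<longlonglongrightarrow> (\<Sum>n. m n (t, x))"
    by (intro summable_LIMSEQ summableI)
  show ?thesis
  proof (rule antisym)
    have "(\<lambda>n. ennreal (C * cosh_term \<kappa> l n t)) \<longlonglongrightarrow> ennreal (C * 0)"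
      by (intro tendsto_ennrealI tendsto_mult_left summable_LIMSEQ_zero sums_summable[OF cosh_term_sums[OF \<kappa>]])
    then have "(\<lambda>n. ennreal C * ennreal (cosh_term \<kappa> l n t)) \<longlonglongrightarrow> 0"
      using C \<kappa> by (simp add: ennreal_mult cosh_term_nonneg)
    from tendsto_add[OF sums this]
    have "(\<lambda>n. (\<Sum>i<n. m i (t, x)) + ennreal C * ennreal (cosh_term \<kappa> l n t)) \<longlonglongrightarrow> (\<Sum>n. m n (t, x))"
      by simp
    then show "V (t, x) \<le> (\<Sum>n. m n (t, x))"
      by (rule LIMSEQ_le_const) (use upper[OF apex_in_cone[OF t]] in blast)
    show "(\<Sum>n. m n (t, x)) \<le> V (t, x)"
      by (rule LIMSEQ_le_const2[OF sums]) (use lower[OF t] in blast)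
  qed
qed

lemma second_moment_nonneg:
  assumes "\<kappa> > 0" "l \<noteq> 0"
  shows "0 \<le> 1 / l\<^sup>2 * K_fun \<kappa> l t x + v\<^sup>2 * H_fun \<kappa> l t"
  using sums_le[OF _ sums_zero bessel_term_sums[OF assms, of t x]] bessel_term_nonneg[OF assms(1)] cosh_real_ge_1
  by (auto simp: H_fun_def intro!: add_nonneg_nonneg)

text \<open>
  Passing from \<open>N\<close> to \<open>v\<^sup>2 + N\<close> removes the inhomogeneity from the integrand, so that the
  iterates are sums of one Bessel and one \<open>cosh\<close> term.  The bound needed for
  \<open>picard_sum\<close> comes from finiteness at the single point \<open>(t,x)\<close>: the equation there controls the
  integral over the whole cone, hence the integrals over all smaller cones with apex in it.
\<close>

lemma second_moment_equation_solution:
  fixes N :: "real \<times> real \<Rightarrow> ennreal"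
  assumes \<kappa>: "\<kappa> > 0" and l: "l \<noteq> 0" and t: "t \<ge> 0"
    and m[measurable]: "(\<lambda>z. N z * indicator ({0..} \<times> UNIV) z) \<in> borel_measurable borel"
    and N: "\<And>s y. s \<ge> 0 \<Longrightarrow> N (s, y) = ennreal ((G \<kappa> s y)\<^sup>2)
        + ennreal (l\<^sup>2 / 4) * cone_integral \<kappa> (\<lambda>w. ennreal (v\<^sup>2) + N w) (s, y)"
    and fin: "N (t, x) < \<infinity>"
  shows "N (t, x) = ennreal (1 / l\<^sup>2 * K_fun \<kappa> l t x + v\<^sup>2 * H_fun \<kappa> l t)"
proof -
  define V where "V z = ennreal (v\<^sup>2) + N z * indicator ({0..} \<times> UNIV) z" for z
  define m where "m n z = ennreal (bessel_term \<kappa> l n z) + ennreal (v\<^sup>2) * ennreal (cosh_term \<kappa> l n (fst z))" for n z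
  have [measurable]: "V \<in> borel_measurable borel" "\<And>n. m n \<in> borel_measurable borel"
    unfolding V_def m_def by measurable
  have NV: "cone_integral \<kappa> (\<lambda>w. ennreal (v\<^sup>2) + N w) z = cone_integral \<kappa> V z" for z
    unfolding cone_integral_def V_def by (intro nn_integral_cong) (auto simp: indicator_def back_cone_def)
  have G2: "(G \<kappa> s y)\<^sup>2 = bessel_term \<kappa> l 0 (s, y)" if "s \<ge> 0" for s y
    using that by (auto simp: G_def bessel_term_def indicator_def abs_le_iff power2_eq_square)
  have Veq: "V (s, y) = m 0 (s, y) + ennreal (l\<^sup>2 / 4) * cone_integral \<kappa> V (s, y)" if "s \<ge> 0" for s y
    using N[OF that, of y, unfolded NV] that by (simp add: V_def[of "(s, y)"] m_def G2 cosh_term_def add_ac)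
  have m0: "m 0 z \<le> ennreal (1/4 + v\<^sup>2)" for z
  proof -
    have "bessel_term \<kappa> l 0 z \<le> 1/4" by (auto simp: bessel_term_def split: prod.split)
    then show ?thesis
      by (simp add: m_def cosh_term_def ennreal_plus[symmetric] bessel_term_nonneg[OF \<kappa>] ennreal_leI del: ennreal_plus)
  qed
  have Vfin: "V (t, x) < \<infinity>" using fin t by (simp add: V_def)
  \<comment> \<open>The cone of \<open>z\<close> is contained in that of \<open>(t, x)\<close>, so the integral in the equation for
    \<open>V z\<close> is at most the one in the equation for \<open>V (t, x)\<close>.\<close>
  have bdd: "V z \<le> ennreal (1/4 + v\<^sup>2 + enn2real (V (t, x)))" if z: "z \<in> back_cone \<kappa> t x" for z
  proof -
    obtain s y where sy: "z = (s, y)" by (cases z)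
    have s: "s \<ge> 0" using z sy by (simp add: back_cone_def)
    have "ennreal (l\<^sup>2 / 4) * cone_integral \<kappa> V (s, y) \<le> ennreal (l\<^sup>2 / 4) * cone_integral \<kappa> V (t, x)"
      using cone_subset[OF \<kappa> z[unfolded sy]] unfolding cone_integral_def
      by (intro mult_left_mono nn_integral_mono) (auto simp: indicator_def)
    also have "\<dots> \<le> V (t, x)" unfolding Veq[OF t, of x] by simp
    finally have "V (s, y) \<le> ennreal (1/4 + v\<^sup>2) + V (t, x)"
      unfolding Veq[OF s] by (intro add_mono m0)
    also have "V (t, x) = ennreal (enn2real (V (t, x)))" using Vfin by simp
    finally show ?thesis by (simp add: sy)
  qed
  have "V (t, x) = (\<Sum>n. m n (t, x))"
  proof (rule picard_sum[where V=V and m=m and l=l, OF \<kappa> t _ _ _ Veq bdd])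
    fix n s y assume s: "(s :: real) \<ge> 0"
    show "ennreal (l\<^sup>2 / 4) * cone_integral \<kappa> (m n) (s, y) = m (Suc n) (s, y)"
      using cone_integral_bessel_term[OF \<kappa>, of l n s y] cone_integral_cosh_term[OF \<kappa> s, of l n y]
      by (simp add: m_def[abs_def] cone_integral_add cone_integral_cmult distrib_left mult.left_commute)
  qed auto
  also have "\<dots> = (\<Sum>n. ennreal (bessel_term \<kappa> l n (t, x) + v\<^sup>2 * cosh_term \<kappa> l n t))"
    by (simp add: m_def ennreal_mult ennreal_plus bessel_term_nonneg cosh_term_nonneg \<kappa>)
  also have "\<dots> = ennreal (1 / l\<^sup>2 * K_fun \<kappa> l t x + v\<^sup>2 * cosh (\<bar>l\<bar> * sqrt (\<kappa> / 2) * t))"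
    using \<kappa> l by (intro suminf_ennreal_eq sums_add sums_mult bessel_term_sums cosh_term_sums)
       (auto simp: bessel_term_nonneg cosh_term_nonneg)
  also have "1 / l\<^sup>2 * K_fun \<kappa> l t x + v\<^sup>2 * cosh (\<bar>l\<bar> * sqrt (\<kappa> / 2) * t)
      = v\<^sup>2 + (1 / l\<^sup>2 * K_fun \<kappa> l t x + v\<^sup>2 * H_fun \<kappa> l t)"
    by (simp add: H_fun_def algebra_simps)
  finally have "ennreal (v\<^sup>2) + N (t, x) = ennreal (v\<^sup>2 + (1 / l\<^sup>2 * K_fun \<kappa> l t x + v\<^sup>2 * H_fun \<kappa> l t))"
    using t by (simp add: V_def)
  moreover note second_moment_nonneg[OF \<kappa> l, of t x v]
  ultimately show ?thesis
    by (simp add: ennreal_plus ennreal_add_left_cancel)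
qed

section \<open>The moments of the solution\<close>

text \<open>
  The integrand of the stochastic convolution is cut off by a backward light cone; products of two
  kernels are then intersections of cones.
\<close>

lemma kernel_eq_cone_indicator:
  assumes "\<kappa> > 0" "s \<ge> 0"
  shows "indicator {0..t} s * G \<kappa> (t - s) (x - r) = 1/2 * indicator (back_cone \<kappa> t x) (s, r)"
proof (cases "s \<le> t")
  case True
  then show ?thesis using assms by (auto simp: G_def back_cone_def indicator_def abs_le_iff)
next
  case False
  then have "\<kappa> * (t - s) < 0" using assms by (simp add: mult_pos_neg)
  then show ?thesis using False by (auto simp: back_cone_def indicator_def)
qed

lemma (in noise_space) second_moment_measurable:
  assumes "(\<lambda>((t, x), \<omega>). u t x \<omega>) \<in> borel_measurable (spacetime \<Otimes>\<^sub>M M)"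
  shows "(\<lambda>z. L2_norm_sq M (u (fst z) (snd z)) * indicator ({0..} \<times> UNIV) z) \<in> borel_measurable borel"
proof -
  have [measurable]: "(\<lambda>p. u (fst (fst p)) (snd (fst p)) (snd p)) \<in> borel_measurable (spacetime \<Otimes>\<^sub>M M)"
    using assms by (simp add: case_prod_unfold)
  have "(\<lambda>z. \<integral>\<^sup>+\<omega>. ennreal ((u (fst z) (snd z) \<omega>)\<^sup>2) \<partial>M) \<in> borel_measurable spacetime"
    by (rule borel_measurable_nn_integral) (simp add: case_prod_unfold)
  then show ?thesis
    unfolding spacetime_def L2_norm_sq_def
    by (subst (asm) borel_measurable_restrict_space_iff_ennreal) (auto intro!: borel_closed closed_Times)
qed

text \<open>
  The form of \<open>\<rho>\<close> enters only here: the isometry produces \<open>E[\<rho>(u)\<^sup>2]\<close>, which is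
  \<open>l\<^sup>2(v\<^sup>2 + E[u\<^sup>2])\<close>, so the second moment satisfies a closed equation.
\<close>

lemma (in noise_space) solution_covariance:
  fixes x y :: real
  assumes \<kappa>: "\<kappa> > 0" and \<rho>: "\<And>x. (\<rho> x)\<^sup>2 = l\<^sup>2 * (v\<^sup>2 + x\<^sup>2)"
    and sol: "wave_solution M W \<kappa> \<rho> (\<lambda>_. 0) (return borel 0) u" and t: "t \<ge> 0"
  defines "R \<equiv> ennreal (l\<^sup>2 / 4) * (\<integral>\<^sup>+z. (ennreal (v\<^sup>2) + L2_norm_sq M (u (fst z) (snd z)))
      * indicator (back_cone \<kappa> t x \<inter> back_cone \<kappa> t y) z \<partial>lborel)"
  shows "R < \<infinity>"
    and "has_bochner_integral M (\<lambda>\<omega>. u t x \<omega> * u t y \<omega>) (G \<kappa> t x * G \<kappa> t y + enn2real R)"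
proof -
  let ?N = "\<lambda>z. L2_norm_sq M (u (fst z) (snd z))"
  let ?C = "back_cone \<kappa> t x \<inter> back_cone \<kappa> t y"
  define X where "X x = (\<lambda>(s, y) \<omega>. indicator {0..t} s * G \<kappa> (t - s) (x - y) * \<rho> (u s y \<omega>))" for x
  obtain J where J: "\<forall>t\<ge>0. \<forall>x. has_walsh_integral M W
        (\<lambda>(s, y) \<omega>. indicator {0..t} s * G \<kappa> (t - s) (x - y) * \<rho> (u s y \<omega>)) (J t x)"
    and uJ: "\<forall>t\<ge>0. \<forall>x. AE \<omega> in M. u t x \<omega> = J0 \<kappa> (\<lambda>_. 0) (return borel 0) t x + J t x \<omega>"
    using sol unfolding wave_solution_def by (elim conjE exE) (rule that; assumption)
  define I where "I = J t"
  have walsh: "has_walsh_integral M W (X x) (I x)" for x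
    using J t unfolding X_def I_def by simp
  have uI: "AE \<omega> in M. u t x \<omega> = G \<kappa> t x + I x \<omega>" for x
    using uJ t by (simp add: J0_dirac I_def)
  have u[measurable]: "u s r \<in> borel_measurable M" if "s \<ge> 0" for s r
    using sol that adapted_measurable unfolding wave_solution_def by blast
  have [measurable]: "(\<lambda>z. ?N z * indicator ({0..} \<times> UNIV) z) \<in> borel_measurable borel"
    using sol by (intro second_moment_measurable) (simp add: wave_solution_def)
  have C: "?C \<subseteq> {0..} \<times> UNIV" by (auto simp: back_cone_def)
  have PX: "X x z \<omega> * X y z \<omega> = l\<^sup>2 / 4 * indicator ?C z * (v\<^sup>2 + (u (fst z) (snd z) \<omega>)\<^sup>2)"
    if "z \<in> space spacetime" for z \<omega>
  proof -
    obtain s r where z: "z = (s, r)" by (cases z)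
    have s: "s \<ge> 0" using that by (simp add: z space_spacetime)
    have "X x z \<omega> * X y z \<omega>
        = (1/2 * indicator (back_cone \<kappa> t x) (s, r)) * (1/2 * indicator (back_cone \<kappa> t y) (s, r)) * (\<rho> (u s r \<omega>))\<^sup>2"
      unfolding kernel_eq_cone_indicator[OF \<kappa> s, symmetric] X_def z by (simp add: power2_eq_square)
    then show ?thesis by (simp add: \<rho> z indicator_inter_arith)
  qed
  note iso = walsh_isometry[OF walsh[of x] walsh[of y]]
  let ?P = "\<lambda>(z, \<omega>). X x z \<omega> * X y z \<omega>"
  have nonneg: "AE p in spacetime \<Otimes>\<^sub>M M. 0 \<le> ?P p"
    by (rule AE_I2) (auto simp: space_pair_measure PX)
  have [measurable]: "?P \<in> borel_measurable (spacetime \<Otimes>\<^sub>M M)"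
    using iso(2) by (rule borel_measurable_integrable)
  have "(\<integral>\<^sup>+p. ennreal (?P p) \<partial>(spacetime \<Otimes>\<^sub>M M)) = (\<integral>\<^sup>+z. (\<integral>\<^sup>+\<omega>. ennreal (?P (z, \<omega>)) \<partial>M) \<partial>spacetime)"
    by (rule nn_integral_fst[symmetric]) simp
  also have "\<dots> = (\<integral>\<^sup>+z. ennreal (l\<^sup>2 / 4) * ((ennreal (v\<^sup>2) + ?N z) * indicator ?C z) \<partial>spacetime)"
  proof (rule nn_integral_cong)
    fix z assume z: "z \<in> space spacetime"
    then have [measurable]: "u (fst z) (snd z) \<in> borel_measurable M"
      by (intro u) (auto simp: space_spacetime)
    have "(\<integral>\<^sup>+\<omega>. ennreal (?P (z, \<omega>)) \<partial>M)
        = (\<integral>\<^sup>+\<omega>. ennreal (l\<^sup>2 / 4) * indicator ?C z * (ennreal (v\<^sup>2) + ennreal ((u (fst z) (snd z) \<omega>)\<^sup>2)) \<partial>M)"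
    proof (rule nn_integral_cong)
      fix \<omega>
      have "?P (z, \<omega>) = l\<^sup>2 / 4 * (indicator ?C z * (v\<^sup>2 + (u (fst z) (snd z) \<omega>)\<^sup>2))"
        using PX[OF z] by (simp add: mult.assoc)
      also have "ennreal \<dots> = ennreal (l\<^sup>2 / 4) * ennreal (indicator ?C z * (v\<^sup>2 + (u (fst z) (snd z) \<omega>)\<^sup>2))"
        by (rule ennreal_mult) auto
      finally show "ennreal (?P (z, \<omega>))
          = ennreal (l\<^sup>2 / 4) * indicator ?C z * (ennreal (v\<^sup>2) + ennreal ((u (fst z) (snd z) \<omega>)\<^sup>2))"
        by (cases "z \<in> ?C") auto
    qed
    also have "\<dots> = ennreal (l\<^sup>2 / 4) * indicator ?C z * (ennreal (v\<^sup>2) + ?N z)"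
      by (simp add: nn_integral_cmult nn_integral_add emeasure_space_1 L2_norm_sq_def)
    finally show "(\<integral>\<^sup>+\<omega>. ennreal (?P (z, \<omega>)) \<partial>M) = ennreal (l\<^sup>2 / 4) * ((ennreal (v\<^sup>2) + ?N z) * indicator ?C z)"
      by (simp add: mult_ac)
  qed
  also have "\<dots> = (\<integral>\<^sup>+z. ennreal (l\<^sup>2 / 4) * ((ennreal (v\<^sup>2) + ?N z * indicator ({0..} \<times> UNIV) z) * indicator ?C z) \<partial>lborel)"
    unfolding nn_integral_spacetime using C by (intro nn_integral_cong) (auto simp: indicator_def)
  also have "\<dots> = ennreal (l\<^sup>2 / 4) * (\<integral>\<^sup>+z. (ennreal (v\<^sup>2) + ?N z * indicator ({0..} \<times> UNIV) z) * indicator ?C z \<partial>lborel)"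
    by (rule nn_integral_cmult) measurable
  also have "(\<integral>\<^sup>+z. (ennreal (v\<^sup>2) + ?N z * indicator ({0..} \<times> UNIV) z) * indicator ?C z \<partial>lborel)
      = (\<integral>\<^sup>+z. (ennreal (v\<^sup>2) + ?N z) * indicator ?C z \<partial>lborel)"
    using C by (intro nn_integral_cong) (auto simp: indicator_def)
  finally have R: "R = ennreal (\<integral>p. ?P p \<partial>(spacetime \<Otimes>\<^sub>M M))"
    unfolding R_def using nn_integral_eq_integral[OF iso(2) nonneg] by simp
  then show "R < \<infinity>" by simp
  have "enn2real R = (\<integral>p. ?P p \<partial>(spacetime \<Otimes>\<^sub>M M))"
    unfolding R by (rule enn2real_ennreal) (rule integral_nonneg_AE[OF nonneg])
  with iso(1) have II: "has_bochner_integral M (\<lambda>\<omega>. I x \<omega> * I y \<omega>) (enn2real R)" by simp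
  have mean: "has_bochner_integral M (I z) 0" for z by (rule walsh_isometry(3)[OF walsh walsh])
  have const: "has_bochner_integral M (\<lambda>_. G \<kappa> t x * G \<kappa> t y) (G \<kappa> t x * G \<kappa> t y)"
    by (simp add: has_bochner_integral_iff prob_space)
  have "has_bochner_integral M
     (\<lambda>\<omega>. G \<kappa> t x * G \<kappa> t y + G \<kappa> t x * I y \<omega> + G \<kappa> t y * I x \<omega> + I x \<omega> * I y \<omega>)
     (G \<kappa> t x * G \<kappa> t y + G \<kappa> t x * 0 + G \<kappa> t y * 0 + enn2real R)"
    by (intro has_bochner_integral_add has_bochner_integral_mult_right const mean II)
  then have *: "has_bochner_integral M (\<lambda>\<omega>. (G \<kappa> t x + I x \<omega>) * (G \<kappa> t y + I y \<omega>)) (G \<kappa> t x * G \<kappa> t y + enn2real R)"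
    by (simp add: algebra_simps)
  have [measurable]: "u t x \<in> borel_measurable M" "u t y \<in> borel_measurable M" using u t by auto
  have "AE \<omega> in M. u t x \<omega> * u t y \<omega> = (G \<kappa> t x + I x \<omega>) * (G \<kappa> t y + I y \<omega>)"
    using uI[of x] uI[of y] by eventually_elim simp
  with * show "has_bochner_integral M (\<lambda>\<omega>. u t x \<omega> * u t y \<omega>) (G \<kappa> t x * G \<kappa> t y + enn2real R)"
    by (subst has_bochner_integral_cong_AE) (auto simp: has_bochner_integral_iff)
qed

text \<open>
  At each time the two cones are intervals of equal radius about \<open>x\<close> and \<open>y\<close>; their
  intersection is centered at the midpoint and has its radius reduced by half the distance.
\<close>

lemma back_cone_Int:
  assumes "\<kappa> > 0"
  shows "back_cone \<kappa> t x \<inter> back_cone \<kappa> t y = back_cone \<kappa> (t - \<bar>x - y\<bar> / (2 * \<kappa>)) ((x + y) / 2)"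
proof -
  have max: "\<bar>z - x\<bar> \<le> b \<and> \<bar>z - y\<bar> \<le> b \<longleftrightarrow> \<bar>z - (x + y) / 2\<bar> \<le> b - \<bar>x - y\<bar> / 2" for z b :: real
    by (cases "x \<le> y") (auto simp: abs_le_iff add_divide_distrib diff_divide_distrib)
  have "\<kappa> * (t - \<bar>x - y\<bar> / (2 * \<kappa>) - s) = \<kappa> * (t - s) - \<bar>x - y\<bar> / 2" for s
    using assms by (simp add: field_simps)
  then have "(s, z) \<in> back_cone \<kappa> t x \<inter> back_cone \<kappa> t y
      \<longleftrightarrow> (s, z) \<in> back_cone \<kappa> (t - \<bar>x - y\<bar> / (2 * \<kappa>)) ((x + y) / 2)" for s z
    using max[of z "\<kappa> * (t - s)"] by (simp add: back_cone_def) blast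
  then show ?thesis by (intro set_eqI) (metis surj_pair)
qed

lemma back_cone_empty: "\<kappa> > 0 \<Longrightarrow> t < 0 \<Longrightarrow> back_cone \<kappa> t x = {}"
  using cone_time_le[of \<kappa> _ _ t x] by (fastforce simp: back_cone_def)

text \<open>
  The initial condition enters through the origin lying in the backward cone, so products of two
  values of \<open>G\<close> also reduce to \<open>back_cone_Int\<close>.
\<close>

lemma G_eq_apex:
  assumes "\<kappa> > 0" shows "G \<kappa> t x = 1/2 * indicator (back_cone \<kappa> t x) (0, 0)"
proof -
  have "0 \<le> t" if "\<bar>x\<bar> \<le> \<kappa> * t"
    using that assms by (smt (verit) mult_pos_neg)
  then show ?thesis by (auto simp: G_def back_cone_def indicator_def abs_le_iff)
qed

theorem corollary3p3:
  fixes M :: "'a measure" and W :: "(real \<times> real) set \<Rightarrow> 'a \<Rightarrow> real"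
    and \<kappa> l v :: real and \<rho> :: "real \<Rightarrow> real" and u :: "real \<Rightarrow> real \<Rightarrow> 'a \<Rightarrow> real"
  assumes "white_noise M W"
    and "\<kappa> > 0"
    and "\<exists>L. L-lipschitz_on UNIV \<rho>"
    and "\<And>x. (\<rho> x)\<^sup>2 = l\<^sup>2 * (v\<^sup>2 + x\<^sup>2)"
    and "l \<noteq> 0" and "v \<ge> 0"
    and "wave_solution M W \<kappa> \<rho> (\<lambda>_. 0) (return borel 0) u"
  shows "(\<forall>t\<ge>0. \<forall>x y. has_bochner_integral M (\<lambda>\<omega>. u t x \<omega> * u t y \<omega>)
            (if x + y = 0 \<and> 2 * \<kappa> * t < \<bar>x - y\<bar> then 0
             else 1 / l\<^sup>2 * K_fun \<kappa> l (T_fun \<kappa> t (x - y)) ((x + y) / 2)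
                    + v\<^sup>2 * H_fun \<kappa> l (T_fun \<kappa> t (x - y)))) \<and>
         (\<forall>t\<ge>0. \<forall>x. L2_norm_sq M (u t x) =
            ennreal (1 / l\<^sup>2 * K_fun \<kappa> l t x + v\<^sup>2 * H_fun \<kappa> l t))"
proof -
  interpret noise_space M W by unfold_locales (rule assms)
  note \<kappa> = assms(2) and sol = assms(7)
  let ?F = "\<lambda>t x. 1 / l\<^sup>2 * K_fun \<kappa> l t x + v\<^sup>2 * H_fun \<kappa> l t"
  define N where "N z = L2_norm_sq M (u (fst z) (snd z))" for z
  define R where "R t x y = ennreal (l\<^sup>2 / 4) *
    (\<integral>\<^sup>+z. (ennreal (v\<^sup>2) + N z) * indicator (back_cone \<kappa> t x \<inter> back_cone \<kappa> t y) z \<partial>lborel)" for t x y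
  note cov = solution_covariance[OF \<kappa> assms(4) sol, folded N_def, folded R_def]
  have eq: "N (t, x) = ennreal ((G \<kappa> t x)\<^sup>2) + R t x x" if t: "t \<ge> 0" for t x
  proof -
    have "has_bochner_integral M (\<lambda>\<omega>. (u t x \<omega>)\<^sup>2) ((G \<kappa> t x)\<^sup>2 + enn2real (R t x x))"
      using cov(2)[OF t, of x x] by (simp add: power2_eq_square)
    then have "N (t, x) = ennreal ((G \<kappa> t x)\<^sup>2 + enn2real (R t x x))"
      unfolding N_def L2_norm_sq_def
      by (subst nn_integral_eq_integral) (auto simp: has_bochner_integral_iff)
    then show ?thesis using cov(1)[OF t, of x x] by (simp add: less_top)
  qed
  have N: "N (t, x) = ennreal (?F t x)" if t: "t \<ge> 0" for t x
  proof (rule second_moment_equation_solution[OF \<kappa> \<open>l \<noteq> 0\<close> t])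
    show "(\<lambda>z. N z * indicator ({0..} \<times> UNIV) z) \<in> borel_measurable borel"
      unfolding N_def using sol by (intro second_moment_measurable) (simp add: wave_solution_def)
    show "N (s, y) = ennreal ((G \<kappa> s y)\<^sup>2) + ennreal (l\<^sup>2 / 4) * cone_integral \<kappa> (\<lambda>w. ennreal (v\<^sup>2) + N w) (s, y)"
      if "s \<ge> 0" for s y
      using eq[OF that, of y] by (simp add: R_def cone_integral_def)
    show "N (t, x) < \<infinity>" using eq[OF t, of x] cov(1)[OF t, of x x] by simp
  qed
  have "has_bochner_integral M (\<lambda>\<omega>. u t x \<omega> * u t y \<omega>)
      (if x + y = 0 \<and> 2 * \<kappa> * t < \<bar>x - y\<bar> then 0 else ?F (T_fun \<kappa> t (x - y)) ((x + y) / 2))"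
    if t: "t \<ge> 0" for t x y
  proof -
    define T where "T = t - \<bar>x - y\<bar> / (2 * \<kappa>)"
    define m where "m = (x + y) / 2"
    \<comment> \<open>The covariance is the right-hand side of the second moment equation at \<open>(T, m)\<close>.\<close>
    have cones: "back_cone \<kappa> t x \<inter> back_cone \<kappa> t y = back_cone \<kappa> T m"
      unfolding T_def m_def by (rule back_cone_Int[OF \<kappa>])
    then have GG: "G \<kappa> t x * G \<kappa> t y = (G \<kappa> T m)\<^sup>2"
      by (simp add: G_eq_apex[OF \<kappa>] indicator_inter_arith[symmetric] power2_eq_square)
    have RR: "R t x y = R T m m" by (simp add: R_def cones)
    have "G \<kappa> t x * G \<kappa> t y + enn2real (R t x y)
        = (if x + y = 0 \<and> 2 * \<kappa> * t < \<bar>x - y\<bar> then 0 else ?F (T_fun \<kappa> t (x - y)) ((x + y) / 2))"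
    proof (cases "T \<ge> 0")
      case True
      then have le: "\<bar>x - y\<bar> \<le> 2 * \<kappa> * t" using \<kappa> by (simp add: T_def field_simps)
      then have TT: "T_fun \<kappa> t (x - y) = T" by (auto simp: T_fun_def T_def indicator_def abs_le_iff)
      have "G \<kappa> t x * G \<kappa> t y + enn2real (R t x y) = enn2real (N (T, m))"
        unfolding eq[OF True] GG RR using cov(1)[OF True, of m m]
        by (subst enn2real_plus) auto
      also have "\<dots> = ?F T m"
        unfolding N[OF True] using second_moment_nonneg[OF \<kappa> \<open>l \<noteq> 0\<close>] by (rule enn2real_ennreal)
      finally show ?thesis using le by (simp add: TT m_def)
    next
      case False
      then have gt: "2 * \<kappa> * t < \<bar>x - y\<bar>" using \<kappa> by (simp add: T_def field_simps)
      then have TT: "T_fun \<kappa> t (x - y) = 0" by (auto simp: T_fun_def indicator_def)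
      have "back_cone \<kappa> T m = {}" using False \<kappa> by (intro back_cone_empty) auto
      then have "G \<kappa> t x * G \<kappa> t y + enn2real (R t x y) = 0"
        unfolding GG by (simp add: G_eq_apex[OF \<kappa>] R_def cones)
      then show ?thesis using gt by (auto simp: TT K_fun_def H_fun_def)
    qed
    with cov(2)[OF t, of x y] show ?thesis by simp
  qed
  then show ?thesis using N by (auto simp: N_def)
qed

end
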